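(* Let $n$ be a positive integer, $K$ a field with $\mathrm{char}(K)=0$ or $\mathrm{char}(K)>n$, and let $A=\bigoplus_{d\ge 0}A_d$ be a commutative graded $K$-algebra with $A_0=K$. Suppose that $A$ is generated as a $K$-algebra by homogeneous elements of the same positive degree $q$. Let $\mathcal{B}$ be the union of $K$-vector space bases of the positive degree homogeneous components of $A$ of degree strictly less than $(n+1)q$ (for example, $\mathcal{B}$ may consist of a set of products of length at most $n$ of the generators of $A$). Then $\{[b]\mid b\in\mathcal{B}\}$ is a minimal homogeneous $K$-algebra generating system of $T^n(A)^{S_n}$.
   Context: $T^n(A)$ is the $n$th tensor power of $A$ over $K$, on which the symmetric group $S_n$ acts by permuting the tensor factors; $T^n(A)^{S_n}$ is the subalgebra of invariants, graded by the grading induced from $A$ (total degree). For $b\in A$, $$[b]:=b\otimes 1\otimes\cdots\otimes 1+1\otimes b\otimes 1\otimes\cdots\otimes 1+\cdots+1\otimes\cdots\otimes 1\otimes b\in T^n(A)^{S_n}.$$ *)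

theory Defs
  imports
    "HOL-Library.Cardinality"
    "HOL-Library.Poly_Mapping"
    "HOL-Algebra.QuotRing"
    "HOL-Algebra.Generated_Rings"
    "HOL-Algebra.Algebraic_Closure_Type"
begin

locale graded_algebra = vector_space scale
  for scale :: "'k::field \<Rightarrow> 'a::comm_ring_1 \<Rightarrow> 'a" +
  fixes gr :: "nat \<Rightarrow> 'a set"
  assumes scale_mult: "scale c (x * y) = scale c x * y"
    and gr_subspace: "subspace (gr d)"
    and gr_direct_sum:
      "\<exists>!f. finite {d. f d \<noteq> 0} \<and> (\<forall>d. f d \<in> gr d) \<and> x = (\<Sum>d | f d \<noteq> 0. f d)"
    and gr_one: "1 \<in> gr 0"
    and gr_mult: "x \<in> gr d \<Longrightarrow> y \<in> gr e \<Longrightarrow> x * y \<in> gr (d + e)"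

text \<open>
  The $K$-subalgebra generated by \<open>S\<close>, where the $K$-algebra structure on the ring \<open>R\<close> is given
  by the structure map \<open>\<iota> : K \<rightarrow> R\<close>, \<open>c \<mapsto> c \<cdot> 1\<close>.
\<close>
definition generated_subalgebra ::
    "('r, 'm) ring_scheme \<Rightarrow> ('k \<Rightarrow> 'r) \<Rightarrow> 'r set \<Rightarrow> 'r set" where
  "generated_subalgebra R \<iota> S = generate_ring R (range \<iota> \<union> S)"

text \<open>\<open>gr d\<close> is the homogeneous component of degree \<open>d\<close> of \<open>R\<close>.\<close>
definition minimal_homogeneous_generating_system ::
    "('r, 'm) ring_scheme \<Rightarrow> ('k \<Rightarrow> 'r) \<Rightarrow> (nat \<Rightarrow> 'r set) \<Rightarrow> 'r set \<Rightarrow> bool" where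
  "minimal_homogeneous_generating_system R \<iota> gr S \<longleftrightarrow>
     S \<subseteq> (\<Union>d. gr d) \<and>
     generated_subalgebra R \<iota> S = carrier R \<and>
     (\<forall>S'. S' \<subset> S \<longrightarrow> generated_subalgebra R \<iota> S' \<noteq> carrier R)"

text \<open>
  $T^n(A)$ is built as the free $K$-module on $A^n$ modulo the multilinearity relations, with $n$ the
  cardinality of the index type \<open>'n\<close>. The monoid $A^n$ under componentwise multiplication is written
  additively, so that the type of finitely supported functions \<open>('n, 'a) factors \<Rightarrow>\<^sub>0 'k\<close> carries
  the multiplication of the monoid algebra $K[A^n]$; in the quotient this becomes
  $(a_1 \otimes \cdots \otimes a_n)(b_1 \otimes \cdots \otimes b_n) =
  a_1b_1 \otimes \cdots \otimes a_nb_n$.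
\<close>
datatype ('n, 'a) factors = Factors (factor: "'n \<Rightarrow> 'a")

instantiation factors :: (type, comm_monoid_mult) comm_monoid_add
begin
definition zero_factors :: "('a, 'b) factors" where
  "zero_factors = Factors (\<lambda>_. 1)"
definition plus_factors :: "('a, 'b) factors \<Rightarrow> ('a, 'b) factors \<Rightarrow> ('a, 'b) factors" where
  "plus_factors x y = Factors (\<lambda>i. factor x i * factor y i)"
instance
  by standard (auto simp: zero_factors_def plus_factors_def mult_ac intro: factors.expand)
end

type_synonym ('n, 'a, 'k) prod_algebra = "('n, 'a) factors \<Rightarrow>\<^sub>0 'k"

type_synonym ('n, 'a, 'k) tensor = "('n, 'a, 'k) prod_algebra set"

definition scalar :: "'k \<Rightarrow> ('n, 'a::comm_monoid_mult, 'k::field) prod_algebra" where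
  "scalar c = Poly_Mapping.single 0 c"

definition monomial :: "('n \<Rightarrow> 'a) \<Rightarrow> ('n, 'a, 'k::field) prod_algebra" where
  "monomial f = Poly_Mapping.single (Factors f) 1"

definition multilinear_relations ::
    "('k::field \<Rightarrow> 'a::comm_ring_1 \<Rightarrow> 'a) \<Rightarrow> ('n, 'a, 'k) prod_algebra set" where
  "multilinear_relations scale =
     {monomial (f(i := x + y)) - monomial (f(i := x)) - monomial (f(i := y)) | f i x y. True} \<union>
     {monomial (f(i := scale c x)) - scalar c * monomial (f(i := x)) | f i c x. True}"

text \<open>
  The set of relations is stable under multiplication by monomials, hence its $K$-linear span is
  already the ideal it generates.
\<close>
definition tensor_ideal ::
    "('k::field \<Rightarrow> 'a::comm_ring_1 \<Rightarrow> 'a) \<Rightarrow> ('n, 'a, 'k) prod_algebra set" where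
  "tensor_ideal scale = Idl\<^bsub>ring_of_type_algebra\<^esub> (multilinear_relations scale)"

definition tensor_power ::
    "('k::field \<Rightarrow> 'a::comm_ring_1 \<Rightarrow> 'a) \<Rightarrow> ('n, 'a, 'k) tensor ring" where
  "tensor_power scale = ring_of_type_algebra Quot tensor_ideal scale"

definition tensor_class ::
    "('k::field \<Rightarrow> 'a::comm_ring_1 \<Rightarrow> 'a) \<Rightarrow> ('n, 'a, 'k) prod_algebra \<Rightarrow> ('n, 'a, 'k) tensor" where
  "tensor_class scale p = tensor_ideal scale +>\<^bsub>ring_of_type_algebra\<^esub> p"

lemma ideal_tensor_ideal: "ideal (tensor_ideal scale) ring_of_type_algebra"
  unfolding tensor_ideal_def
  by (intro ring.genideal_ideal ring_from_type_algebra) (simp add: ring_of_type_algebra_def)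

lemma cring_tensor_power: "cring (tensor_power scale)"
  unfolding tensor_power_def
  by (intro ideal.quotient_is_cring ideal_tensor_ideal cring_from_type_algebra)

lemma tensor_class_ring_hom:
  "tensor_class scale \<in> ring_hom ring_of_type_algebra (tensor_power scale)"
  using ideal.rcos_ring_hom[OF ideal_tensor_ideal, of scale] unfolding tensor_power_def
  by (simp add: tensor_class_def[abs_def])

definition tensor_scalar ::
    "('k::field \<Rightarrow> 'a::comm_ring_1 \<Rightarrow> 'a) \<Rightarrow> 'k \<Rightarrow> ('n, 'a, 'k) tensor" where
  "tensor_scalar scale c = tensor_class scale (scalar c)"

definition pure_tensor ::
    "('k::field \<Rightarrow> 'a::comm_ring_1 \<Rightarrow> 'a) \<Rightarrow> ('n \<Rightarrow> 'a) \<Rightarrow> ('n, 'a, 'k) tensor" where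
  "pure_tensor scale f = tensor_class scale (monomial f)"

lemma pure_tensor_mult:
  fixes scale :: "'k::field \<Rightarrow> 'a::comm_ring_1 \<Rightarrow> 'a" and f g :: "'n \<Rightarrow> 'a"
  shows "pure_tensor scale f \<otimes>\<^bsub>tensor_power scale\<^esub> pure_tensor scale g =
    pure_tensor scale (\<lambda>i. f i * g i)"
proof -
  have "monomial f * monomial g = (monomial (\<lambda>i. f i * g i) :: ('n, 'a, 'k) prod_algebra)"
    by (simp add: monomial_def mult_single plus_factors_def)
  then show ?thesis
    using ring_hom_mult[OF tensor_class_ring_hom, of "monomial f" "monomial g" scale]
    by (simp add: pure_tensor_def ring_of_type_algebra_def)
qed

definition permute_factors ::
    "('n \<Rightarrow> 'n) \<Rightarrow> ('n, 'a, 'k::zero) prod_algebra \<Rightarrow> ('n, 'a, 'k) prod_algebra" where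
  "permute_factors \<sigma> = Poly_Mapping.map_key (\<lambda>t. Factors (factor t \<circ> \<sigma>))"

lemma permute_factors_monomial:
  fixes f :: "'n \<Rightarrow> 'a"
  assumes "bij \<sigma>"
  shows "permute_factors \<sigma> (monomial f) = monomial (f \<circ> inv_into UNIV \<sigma>)"
proof -
  let ?h = "\<lambda>t :: ('n, 'a) factors. Factors (factor t \<circ> \<sigma>)"
  have "inj ?h"
  proof (rule injI)
    fix x y :: "('n, 'a) factors"
    assume "?h x = ?h y"
    then have eq: "factor x \<circ> \<sigma> = factor y \<circ> \<sigma>" by simp
    have "factor x i = factor y i" for i
      using fun_cong[OF eq, of "inv_into UNIV \<sigma> i"] assms
      by (simp add: bij_is_surj surj_f_inv_f)
    then show "x = y" by (intro factors.expand ext)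
  qed
  from map_key_single[OF this, of "Factors (f \<circ> inv_into UNIV \<sigma>)"]
  show ?thesis
    using assms by (simp add: permute_factors_def monomial_def comp_assoc bij_is_inj)
qed

definition permute_tensor ::
    "('n \<Rightarrow> 'n) \<Rightarrow> ('n, 'a, 'k::zero) tensor \<Rightarrow> ('n, 'a, 'k) tensor" where
  "permute_tensor \<sigma> t = permute_factors \<sigma> ` t"

definition symmetric_tensors ::
    "('k::field \<Rightarrow> 'a::comm_ring_1 \<Rightarrow> 'a) \<Rightarrow> ('n, 'a, 'k) tensor ring" where
  "symmetric_tensors scale = (tensor_power scale)
     \<lparr>carrier := {t \<in> carrier (tensor_power scale). \<forall>\<sigma>. bij \<sigma> \<longrightarrow> permute_tensor \<sigma> t = t}\<rparr>"

text \<open>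
  The component of total degree \<open>d\<close> of $T^n(A)$, spanned by the $a_1 \otimes \cdots \otimes a_n$
  with $a_i$ homogeneous of degree $d_i$ and $d_1 + \cdots + d_n = d$.
\<close>
definition tensor_gr ::
    "('k::field \<Rightarrow> 'a::comm_ring_1 \<Rightarrow> 'a) \<Rightarrow> (nat \<Rightarrow> 'a set) \<Rightarrow> nat \<Rightarrow>
     ('n::finite, 'a, 'k) tensor set" where
  "tensor_gr scale gr d = tensor_class scale `
     module.span (\<lambda>c p. scalar c * p)
       {monomial f | f. \<exists>deg. (\<forall>i. f i \<in> gr (deg i)) \<and> (\<Sum>i\<in>UNIV. deg i) = d}"

definition symmetric_tensor_gr ::
    "('k::field \<Rightarrow> 'a::comm_ring_1 \<Rightarrow> 'a) \<Rightarrow> (nat \<Rightarrow> 'a set) \<Rightarrow> nat \<Rightarrow>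
     ('n::finite, 'a, 'k) tensor set" where
  "symmetric_tensor_gr scale gr d = tensor_gr scale gr d \<inter> carrier (symmetric_tensors scale)"

definition bracket ::
    "('k::field \<Rightarrow> 'a::comm_ring_1 \<Rightarrow> 'a) \<Rightarrow> 'a \<Rightarrow> ('n::finite, 'a, 'k) tensor" where
  "bracket scale b = (\<Oplus>\<^bsub>tensor_power scale\<^esub>i\<in>UNIV. pure_tensor scale ((\<lambda>_. 1)(i := b)))"

end

theory Submission
  imports Defs "HOL-Combinatorics.Permutations"
begin

text \<open>
  Let $n$ be the number of tensor factors and $R = T^n(A)^{S_n}$. The computations take place in
  the monoid algebra \<open>prod_algebra\<close> above $T^n(A)$. There the map \<open>slot p\<close>, which puts an element
  into factor $p$ and $1$ elsewhere, is multiplicative on the nose; only its linearity depends on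
  the tensor ideal.

  Generation. Since $n!$ is invertible, every element of $R$ is a linear combination of orbit
  sums of pure tensors. An orbit sum is the case $k = n$ of the sum $M(x_1,\dots,x_k)$ over all
  injective placements of $x_1,\dots,x_k$ into the $n$ factors (\<open>placement_sum\<close>). The product rule
  \[ [a]\, M(x_1,\dots,x_k) = M(a,x_1,\dots,x_k) + \sum_i M(x_1,\dots,a x_i,\dots,x_k) \]
  (lemma \<open>placement_sum_times_single\<close>) gives by induction on $k$
  \[ M(x_1,\dots,x_k) \equiv (-1)^{k-1} (k-1)!\, [x_1 \cdots x_k] \]
  modulo polynomials in brackets of shorter products (lemma \<open>placement_sum_mod_subring\<close>). So all
  orbit sums are polynomials in brackets. For $k = n+1$ there is no injective placement and
  $M = 0$; as $n!$ is invertible, a bracket of a product of more than $n$ generators of $A$ is a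
  polynomial in brackets of shorter products. What remains are products of at most $n$ generators,
  and these lie in degrees below $(n+1)q$.

  Minimality. Write $a = a^0 + a^+$ for the splitting of $a \in A$ into its part of degree $0$
  and the rest. For a linear functional $l$ on $A$ put
  \[ \Phi(a_1 \otimes \cdots \otimes a_n) =
     \sum_{S} c_{|S|}\; l\Bigl(\prod_{i \in S} a_i^+ \prod_{i \notin S} a_i^0\Bigr), \]
  where $c_0 = 0$, $n c_1 = 1$ and $k c_k + (n-k) c_{k+1} = 0$ for $0 < k < n$. With these
  coefficients $\Phi([b]\,y) = l(b \prod_i y_i^0) + n c_n\, l(b \prod_i y_i^+)$ for every pure
  tensor $y$ and every homogeneous $b$ of positive degree: everything between the two extreme
  subsets $S$ cancels. As $A$ has nothing in degrees strictly between $0$ and $q$, the argument of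
  the last $l$ lives in degrees at least $(n+1)q$. Let $l$ be the functional that is $1$ on a given
  $b_0 \in \mathcal{B}$ and $0$ on the rest of $\mathcal{B}$ and on all degrees other than that of $b_0$.
  The first $l$ is a multiple of $l(b)$ because $A_0 = K$.
  Hence $\Phi([b]\,y) = 0$ for all $y$ and all $b \in \mathcal{B}$ other than $b_0$, so $\Phi$
  vanishes on the algebra generated by these $[b]$, whereas $\Phi([b_0]) = 1$
  (lemma \<open>bracket_not_generated\<close>).
\<close>

section \<open>Sums over injective placements\<close>

text \<open>
  The set \<open>C\<close> stands for the preimage, in the monoid algebra above the tensor power, of a subalgebra
  of the tensor power.
\<close>
locale subring_of_type =
  fixes C :: "'r::comm_ring_1 set"
  assumes one_closed: "1 \<in> C"
    and diff_closed: "x \<in> C \<Longrightarrow> y \<in> C \<Longrightarrow> x - y \<in> C"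
    and mult_closed: "x \<in> C \<Longrightarrow> y \<in> C \<Longrightarrow> x * y \<in> C"
begin

lemma zero_closed: "0 \<in> C"
  using diff_closed[OF one_closed one_closed] by simp

lemma uminus_closed: "x \<in> C \<Longrightarrow> - x \<in> C"
  using diff_closed[OF zero_closed] by simp

lemma add_closed: "x \<in> C \<Longrightarrow> y \<in> C \<Longrightarrow> x + y \<in> C"
  using diff_closed[of x "- y"] uminus_closed by simp

lemma sum_closed: "(\<And>i. i \<in> A \<Longrightarrow> f i \<in> C) \<Longrightarrow> sum f A \<in> C"
  by (induction A rule: infinite_finite_induct) (auto simp: zero_closed add_closed)

lemma of_nat_closed: "of_nat m \<in> C"
  by (induction m) (auto simp: zero_closed one_closed add_closed)

lemma power_closed: "x \<in> C \<Longrightarrow> x ^ m \<in> C"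
  by (induction m) (auto simp: one_closed mult_closed)

end

text \<open>
  The sum of $\iota_{p_1}(x_1) \cdots \iota_{p_k}(x_k)$ over all sequences of distinct positions
  $p_1,\dots,p_k$ outside \<open>U\<close>. The set \<open>U\<close> of occupied positions is an argument because it grows
  along the recursion.
\<close>
primrec placement_sum ::
    "('n::finite \<Rightarrow> 'a \<Rightarrow> 'r::comm_ring_1) \<Rightarrow> 'n set \<Rightarrow> 'a list \<Rightarrow> 'r" where
  "placement_sum \<iota> U [] = 1"
| "placement_sum \<iota> U (x # xs) = (\<Sum>p\<in>-U. \<iota> p x * placement_sum \<iota> (insert p U) xs)"

lemma placement_sum_swap:
  "placement_sum \<iota> U (x # y # xs) = placement_sum \<iota> U (y # x # xs)"
proof -
  have swapped: "placement_sum \<iota> U (x # y # xs) =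
      (\<Sum>p\<in>-U. \<Sum>r | r \<in> -U \<and> r \<noteq> p.
        \<iota> p x * (\<iota> r y * placement_sum \<iota> (insert p (insert r U)) xs))" for x y
  proof -
    have "- insert p U = {r \<in> -U. r \<noteq> p}" for p by auto
    then show ?thesis by (simp add: sum_distrib_left insert_commute)
  qed
  have "placement_sum \<iota> U (x # y # xs) =
      (\<Sum>r\<in>-U. \<Sum>p | p \<in> -U \<and> r \<noteq> p.
        \<iota> p x * (\<iota> r y * placement_sum \<iota> (insert p (insert r U)) xs))"
    unfolding swapped by (rule sum.swap_restrict) auto
  also have "\<dots> = placement_sum \<iota> U (y # x # xs)"
    unfolding swapped by (intro sum.cong refl) (auto simp: mult_ac insert_commute)
  finally show ?thesis .
qed

text \<open>
  In the product of \<open>[a]\<close> with a placement of \<open>xs\<close>, the element \<open>a\<close> either lands on a free position,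
  which gives a placement of \<open>a # xs\<close>, or on the position of some \<open>xs ! i\<close>, where the two factors
  merge because $\iota_p$ is multiplicative.
\<close>
lemma placement_sum_times_single:
  assumes mult: "\<And>p x y. \<iota> p (x * y) = \<iota> p x * \<iota> p (y :: 'a::monoid_mult)"
  shows "(\<Sum>p\<in>-U. \<iota> p a) * placement_sum \<iota> U xs =
    placement_sum \<iota> U (a # xs) + (\<Sum>i<length xs. placement_sum \<iota> U (xs[i := a * xs ! i]))"
proof (induction xs arbitrary: U)
  case Nil
  show ?case by simp
next
  case (Cons x xs)
  have split: "(\<Sum>p\<in>-U. \<iota> p a) = \<iota> r a + (\<Sum>p\<in>-insert r U. \<iota> p a)" if "r \<in> -U" for r
    using that by (simp add: sum.remove Compl_insert)
  let ?M = "\<lambda>r ys. placement_sum \<iota> (insert r U) ys"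
  have "(\<Sum>p\<in>-U. \<iota> p a) * placement_sum \<iota> U (x # xs) =
      (\<Sum>r\<in>-U. \<iota> r x * ((\<Sum>p\<in>-U. \<iota> p a) * ?M r xs))"
    by (simp add: sum_distrib_left mult_ac)
  also have "\<dots> = (\<Sum>r\<in>-U. \<iota> r (a * x) * ?M r xs + \<iota> r x * ?M r (a # xs) +
      (\<Sum>i<length xs. \<iota> r x * ?M r (xs[i := a * xs ! i])))"
  proof (rule sum.cong[OF refl])
    fix r assume r: "r \<in> -U"
    have "\<iota> r x * ((\<Sum>p\<in>-U. \<iota> p a) * ?M r xs) =
        \<iota> r x * (\<iota> r a * ?M r xs + (\<Sum>p\<in>-insert r U. \<iota> p a) * ?M r xs)"
      unfolding split[OF r] by (simp only: distrib_right)
    then show "\<iota> r x * ((\<Sum>p\<in>-U. \<iota> p a) * ?M r xs) =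
        \<iota> r (a * x) * ?M r xs + \<iota> r x * ?M r (a # xs) +
        (\<Sum>i<length xs. \<iota> r x * ?M r (xs[i := a * xs ! i]))"
      unfolding Cons.IH mult by (simp add: algebra_simps sum_distrib_left)
  qed
  also have "\<dots> = placement_sum \<iota> U (a * x # xs) + placement_sum \<iota> U (x # a # xs) +
      (\<Sum>i<length xs. placement_sum \<iota> U (x # xs[i := a * xs ! i]))"
    by (simp add: sum.distrib sum.swap[of _ "-U"])
  also have "\<dots> = placement_sum \<iota> U (a # x # xs) +
      (\<Sum>i<length (x # xs). placement_sum \<iota> U ((x # xs)[i := a * (x # xs) ! i]))"
    unfolding placement_sum_swap[of \<iota> U x a] length_Cons sum.lessThan_Suc_shift
    by (simp add: algebra_simps)
  finally show ?case .
qed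

lemma placement_sum_eq_0:
  "card (-U) < length xs \<Longrightarrow> placement_sum \<iota> U xs = 0"
proof (induction xs arbitrary: U)
  case (Cons x xs)
  have "placement_sum \<iota> (insert p U) xs = 0" if "p \<in> -U" for p
  proof (rule Cons.IH)
    have "- insert p U = -U - {p}" by auto
    moreover have "card (-U) > 0" using that by (auto simp: card_gt_0_iff)
    ultimately show "card (- insert p U) < length xs"
      using that Cons.prems by (simp add: card_Diff_singleton)
  qed
  then show ?case by simp
qed simp

text \<open>
  Let \<open>hss\<close> have length $k$. Solving the product rule for the placement sum of \<open>gs # hss\<close> leaves,
  up to sign, $k$ placement sums of length $k$ in which \<open>gs\<close> has been merged with one of the entries. By induction each of them is
  $(-1)^{k-1} (k-1)!\,[\cdots]$ modulo \<open>C\<close>, and they add up to $-(-1)^k\, k!\,[\cdots]$.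

  The entries are nonempty words over \<open>H\<close> and not just elements, so that ``shorter product'' has
  a meaning: the word length survives merging and turns the condition on \<open>C\<close> into the induction
  hypothesis of a later induction on the length of a word.
\<close>
lemma (in subring_of_type) placement_sum_mod_subring:
  fixes \<iota> :: "'n::finite \<Rightarrow> 'a::comm_monoid_mult \<Rightarrow> 'r" and H :: "'a set"
  assumes mult: "\<And>p x y. \<iota> p (x * y) = \<iota> p x * \<iota> p y"
    and short: "\<And>hs. set hs \<subseteq> H \<Longrightarrow> length hs < m \<Longrightarrow> (\<Sum>p\<in>UNIV. \<iota> p (prod_list hs)) \<in> C"
  shows "gss \<noteq> [] \<Longrightarrow> (\<And>gs. gs \<in> set gss \<Longrightarrow> gs \<noteq> [] \<and> set gs \<subseteq> H) \<Longrightarrow> length (concat gss) \<le> m \<Longrightarrow>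
    placement_sum \<iota> {} (map prod_list gss) -
      (- 1) ^ (length gss - 1) * of_nat (fact (length gss - 1)) *
        (\<Sum>p\<in>UNIV. \<iota> p (prod_list (concat gss))) \<in> C"
proof (induction "length gss" arbitrary: gss rule: less_induct)
  case less
  obtain gs hss where gss: "gss = gs # hss"
    using less.prems(1) by (cases gss) auto
  let ?br = "\<lambda>x. \<Sum>p\<in>UNIV. \<iota> p x"
  let ?M = "\<lambda>xss. placement_sum \<iota> {} (map prod_list xss)"
  have gs: "gs \<noteq> []" "set gs \<subseteq> H" using less.prems(2)[of gs] gss by auto
  show ?case
  proof (cases "hss = []")
    case True
    then show ?thesis by (simp add: gss zero_closed)
  next
    case False
    define j where "j = length hss - 1"
    have j: "length hss = Suc j" using False by (simp add: j_def)
    define c :: 'r where "c = (- 1) ^ j * of_nat (fact j)"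
    define b where "b = ?br (prod_list (concat gss))"
    have c: "c \<in> C"
      unfolding c_def by (intro mult_closed power_closed uminus_closed one_closed of_nat_closed)
    have hss: "g \<noteq> [] \<and> set g \<subseteq> H" if "g \<in> set hss" for g
      using less.prems(2)[of g] gss that by auto
    have len: "length gs + length (concat hss) \<le> m" using less.prems(3) gss by simp
    have hss_pos: "length (concat hss) > 0" using False hss by (cases hss) auto
    \<comment> \<open>The word gs is nonempty, so the remaining words have total length below m.\<close>
    have M_hss: "?M hss \<in> C"
    proof -
      have "?M hss - c * ?br (prod_list (concat hss)) \<in> C"
        unfolding c_def j_def using less.hyps[of hss] False hss len gss by simp
      moreover have "?br (prod_list (concat hss)) \<in> C"
      proof (rule short)
        show "set (concat hss) \<subseteq> H" using hss by auto
        show "length (concat hss) < m" using len gs(1)[folded length_greater_0_conv] by linarith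
      qed
      ultimately show ?thesis
        using add_closed[of "?M hss - c * ?br (prod_list (concat hss))"
            "c * ?br (prod_list (concat hss))"] mult_closed[OF c] by simp
    qed
    have merged: "?M (hss[i := gs @ hss ! i]) - c * b \<in> C" if i: "i < length hss" for i
    proof -
      let ?hss = "hss[i := gs @ hss ! i]"
      have concat: "mset (concat ?hss) = mset (concat gss)"
      proof -
        obtain as bs where "hss = as @ hss ! i # bs" "length as = i"
          using id_take_nth_drop[OF i] i by (metis length_take min.absorb2 less_imp_le)
        then have "concat hss = concat as @ hss ! i @ concat bs"
            "concat ?hss = concat as @ (gs @ hss ! i) @ concat bs"
          by (metis concat.simps(2) concat_append, metis concat.simps(2) concat_append list_update_length)
        then show ?thesis by (simp add: gss)
      qed
      have "prod_list (concat ?hss) = prod_list (concat gss)"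
        using arg_cong[OF concat, of prod_mset] by (simp only: prod_mset_prod_list)
      moreover have "length (concat ?hss) \<le> m"
        using arg_cong[OF concat, of size] less.prems(3) by (simp only: size_mset)
      moreover have "g \<noteq> [] \<and> set g \<subseteq> H" if "g \<in> set ?hss" for g
      proof -
        have "g = gs @ hss ! i \<or> g \<in> set hss"
          using that by (auto dest!: subsetD[OF set_update_subset_insert])
        then show ?thesis using hss[of g] hss[OF nth_mem[OF i]] gs by auto
      qed
      ultimately show ?thesis
        unfolding b_def c_def j_def using less.hyps[of ?hss] False gss by simp
    qed
    have "?br (prod_list gs) * ?M hss = ?M gss +
        (\<Sum>i<length hss. ?M (hss[i := gs @ hss ! i]))"
      using placement_sum_times_single[of \<iota> "prod_list gs" "{}" "map prod_list hss", OF mult]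
      by (simp add: gss map_update)
    moreover have "of_nat (length hss) * (c * b) =
        - ((- 1) ^ (length gss - 1) * of_nat (fact (length gss - 1)) * b)"
      by (simp add: gss c_def j algebra_simps)
    ultimately have "?M gss - (- 1) ^ (length gss - 1) * of_nat (fact (length gss - 1)) * b =
        ?br (prod_list gs) * ?M hss - (\<Sum>i<length hss. ?M (hss[i := gs @ hss ! i]) - c * b)"
      by (simp add: sum_subtractf algebra_simps)
    moreover have "?br (prod_list gs) \<in> C" using gs(2) len hss_pos by (intro short; linarith)
    moreover have "(\<Sum>i<length hss. ?M (hss[i := gs @ hss ! i]) - c * b) \<in> C"
      by (rule sum_closed) (simp add: merged)
    ultimately show ?thesis
      unfolding b_def[symmetric] using M_hss by (simp only: diff_closed mult_closed)
  qed
qed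

lemma placement_sum_distinct_lists:
  fixes \<iota> :: "'n::finite \<Rightarrow> 'a \<Rightarrow> 'r::comm_ring_1"
  shows "placement_sum \<iota> U xs =
    (\<Sum>ps | length ps = length xs \<and> distinct ps \<and> set ps \<inter> U = {}. prod_list (map2 \<iota> ps xs))"
proof (induction xs arbitrary: U)
  case Nil
  have "{ps :: 'n list. length ps = length ([] :: 'a list) \<and> distinct ps \<and> set ps \<inter> U = {}} = {[]}" by auto
  then show ?case by (simp only:) simp
next
  case (Cons x xs)
  let ?A = "\<lambda>k U. {ps :: 'n list. length ps = k \<and> distinct ps \<and> set ps \<inter> U = {}}"
  have fin: "finite (?A k U)" for k U
    by (rule finite_subset[OF _ finite_lists_length_eq[of UNIV k]]) auto
  have "?A (length (x # xs)) U = (\<Union>p\<in>-U. (#) p ` ?A (length xs) (insert p U))"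
    by (auto simp: length_Suc_conv image_iff)
  then have "(\<Sum>ps \<in> ?A (length (x # xs)) U. prod_list (map2 \<iota> ps (x # xs))) =
      (\<Sum>p\<in>-U. \<Sum>ps\<in>(#) p ` ?A (length xs) (insert p U). prod_list (map2 \<iota> ps (x # xs)))"
    by (simp only:) (intro sum.UNION_disjoint ballI finite_imageI fin, auto)
  also have "\<dots> = placement_sum \<iota> U (x # xs)"
    by (simp add: sum.reindex Cons.IH sum_distrib_left)
  finally show ?case by simp
qed

text \<open>
  If there are as many elements as positions, an injective placement is a permutation, so the
  placement sum is an orbit sum.
\<close>
lemma sum_bij_eq_placement_sum:
  fixes \<iota> :: "'n::finite \<Rightarrow> 'a \<Rightarrow> 'r::comm_ring_1"
  assumes ps: "distinct ps" "set ps = (UNIV :: 'n set)"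
  shows "(\<Sum>\<sigma> | bij \<sigma>. \<Prod>p\<in>UNIV. \<iota> (\<sigma> p) (f p)) = placement_sum \<iota> {} (map f ps)"
proof -
  let ?D = "{qs :: 'n list. length qs = length ps \<and> distinct qs}"
  have card: "length ps = CARD('n)" using ps distinct_card by metis
  have "bij_betw (\<lambda>\<sigma>. map \<sigma> ps) {\<sigma>. bij \<sigma>} ?D"
  proof (rule bij_betwI')
    fix \<sigma> \<tau> :: "'n \<Rightarrow> 'n"
    show "(map \<sigma> ps = map \<tau> ps) = (\<sigma> = \<tau>)" using ps by (auto simp: fun_eq_iff)
  next
    fix \<sigma> :: "'n \<Rightarrow> 'n" assume "\<sigma> \<in> {\<sigma>. bij \<sigma>}"
    then show "map \<sigma> ps \<in> ?D" using ps by (auto simp: distinct_map bij_def)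
  next
    fix qs assume qs: "qs \<in> ?D"
    define \<sigma> where "\<sigma> = (\<lambda>p. the (map_of (zip ps qs) p))"
    have qs_eq: "qs = map \<sigma> ps"
      using ps qs by (intro nth_equalityI) (auto simp: \<sigma>_def map_of_zip_nth)
    have "set qs = UNIV"
      using qs card by (intro card_subset_eq) (auto simp: distinct_card)
    then have "surj \<sigma>" using qs_eq ps by (metis list.set_map)
    then have "bij \<sigma>" by (simp add: finite_UNIV_surj_inj bij_def)
    with qs_eq show "\<exists>\<sigma>\<in>{\<sigma>. bij \<sigma>}. qs = map \<sigma> ps" by auto
  qed
  then have "(\<Sum>qs\<in>?D. prod_list (map2 \<iota> qs (map f ps))) =
      (\<Sum>\<sigma> | bij \<sigma>. prod_list (map2 \<iota> (map \<sigma> ps) (map f ps)))"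
    by (rule sum.reindex_bij_betw[symmetric])
  moreover have "prod_list (map2 \<iota> (map \<sigma> ps) (map f ps)) = (\<Prod>p\<in>UNIV. \<iota> (\<sigma> p) (f p))" for \<sigma>
    using prod.distinct_set_conv_list[OF ps(1), of "\<lambda>p. \<iota> (\<sigma> p) (f p)"] ps
    by (simp add: zip_map_map zip_same_conv_map comp_def)
  ultimately show ?thesis by (simp add: placement_sum_distinct_lists)
qed

section \<open>The monoid algebra above the tensor power\<close>

lemma a_inv_of_type: "\<ominus>\<^bsub>ring_of_type_algebra\<^esub> x = - (x :: 'r::comm_ring_1)"
proof -
  interpret R: ring "ring_of_type_algebra :: 'r ring" ..
  show ?thesis by (rule R.minus_equality) (simp_all add: ring_of_type_algebra_def)
qed

lemma ideal_of_type:
  fixes J :: "'r::comm_ring_1 set"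
  assumes "0 \<in> J" and add: "\<And>x y. x \<in> J \<Longrightarrow> y \<in> J \<Longrightarrow> x + y \<in> J"
    and mult: "\<And>r x. x \<in> J \<Longrightarrow> r * x \<in> J"
  shows "ideal J ring_of_type_algebra"
proof (rule idealI[OF ring_from_type_algebra])
  show "subgroup J (add_monoid (ring_of_type_algebra :: 'r ring))"
  proof (rule subgroup.intro)
    fix x assume "x \<in> J"
    then show "inv\<^bsub>add_monoid (ring_of_type_algebra :: 'r ring)\<^esub> x \<in> J"
      using a_inv_of_type[of x] mult[of x "-1"] by (simp add: a_inv_def)
  qed (use assms in \<open>auto simp: ring_of_type_algebra_def\<close>)
qed (use mult in \<open>auto simp: ring_of_type_algebra_def mult.commute\<close>)

lemma tensor_ideal_minimal:
  assumes "multilinear_relations scale \<subseteq> J"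
    and "0 \<in> J" "\<And>x y. x \<in> J \<Longrightarrow> y \<in> J \<Longrightarrow> x + y \<in> J" "\<And>r x. x \<in> J \<Longrightarrow> r * x \<in> J"
  shows "tensor_ideal scale \<subseteq> J"
  unfolding tensor_ideal_def
  by (rule ring.genideal_minimal[OF _ ideal_of_type]) (use assms in auto)

lemma multilinear_relations_subset: "multilinear_relations scale \<subseteq> tensor_ideal scale"
  unfolding tensor_ideal_def
  by (rule ring.genideal_self) (auto simp: ring_of_type_algebra_def ring_from_type_algebra[unfolded ring_of_type_algebra_def])

lemma tensor_ideal_mult: "x \<in> tensor_ideal scale \<Longrightarrow> r * x \<in> tensor_ideal scale"
  using ideal.I_l_closed[OF ideal_tensor_ideal, of x scale r] by (simp add: ring_of_type_algebra_def)

lemma tensor_ideal_zero: "0 \<in> tensor_ideal scale"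
  using additive_subgroup.zero_closed[OF ideal.axioms(1)[OF ideal_tensor_ideal], of scale]
  by (simp add: ring_of_type_algebra_def)

lemma tensor_ideal_add:
  "x \<in> tensor_ideal scale \<Longrightarrow> y \<in> tensor_ideal scale \<Longrightarrow> x + y \<in> tensor_ideal scale"
  using additive_subgroup.a_closed[OF ideal.axioms(1)[OF ideal_tensor_ideal], of x scale y]
  by (simp add: ring_of_type_algebra_def)

lemma tensor_ideal_uminus: "x \<in> tensor_ideal scale \<Longrightarrow> - x \<in> tensor_ideal scale"
  using tensor_ideal_mult[of x scale "- 1"] by simp

lemma tensor_class_eq: "tensor_class scale p = (\<lambda>h. h + p) ` tensor_ideal scale"
  by (auto simp: tensor_class_def a_r_coset_def' ring_of_type_algebra_def)

lemma tensor_class_eq_iff: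
  "tensor_class scale p = tensor_class scale p' \<longleftrightarrow> p - p' \<in> tensor_ideal scale"
proof
  assume "tensor_class scale p = tensor_class scale p'"
  moreover have "p \<in> tensor_class scale p"
    using tensor_ideal_zero by (force simp: tensor_class_eq)
  ultimately show "p - p' \<in> tensor_ideal scale" by (auto simp: tensor_class_eq)
next
  have subset: "tensor_class scale p \<subseteq> tensor_class scale p'"
    if "p - p' \<in> tensor_ideal scale" for p p'
  proof
    fix x assume "x \<in> tensor_class scale p"
    then obtain h where "h \<in> tensor_ideal scale" "x = (h + (p - p')) + p'"
      by (auto simp: tensor_class_eq)
    then show "x \<in> tensor_class scale p'"
      unfolding tensor_class_eq using tensor_ideal_add[OF _ that, of h] by blast
  qed
  assume "p - p' \<in> tensor_ideal scale"
  then show "tensor_class scale p = tensor_class scale p'"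
    using subset[of p p'] subset[of p' p] tensor_ideal_uminus[of "p - p'"] by auto
qed

lemma carrier_tensor_power: "carrier (tensor_power scale) = range (tensor_class scale)"
  by (auto simp: tensor_power_def FactRing_def A_RCOSETS_def' tensor_class_def ring_of_type_algebra_def)

lemma tensor_class_add:
  "tensor_class scale (p + p') = tensor_class scale p \<oplus>\<^bsub>tensor_power scale\<^esub> tensor_class scale p'"
  using ring_hom_add[OF tensor_class_ring_hom, of p p' scale] by (simp add: ring_of_type_algebra_def)

lemma tensor_class_mult:
  "tensor_class scale (p * p') = tensor_class scale p \<otimes>\<^bsub>tensor_power scale\<^esub> tensor_class scale p'"
  using ring_hom_mult[OF tensor_class_ring_hom, of p p' scale] by (simp add: ring_of_type_algebra_def)

lemma tensor_class_one: "tensor_class scale 1 = \<one>\<^bsub>tensor_power scale\<^esub>"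
  using ring_hom_one[OF tensor_class_ring_hom, of scale] by (simp add: ring_of_type_algebra_def)

lemma tensor_class_zero: "tensor_class scale 0 = \<zero>\<^bsub>tensor_power scale\<^esub>"
  by (auto simp: tensor_class_eq tensor_power_def FactRing_def)

lemma tensor_class_uminus:
  "tensor_class scale (- p) = \<ominus>\<^bsub>tensor_power scale\<^esub> tensor_class scale p"
proof -
  interpret T: cring "tensor_power scale" by (rule cring_tensor_power)
  show ?thesis
    by (rule T.minus_equality[symmetric])
      (auto simp: carrier_tensor_power simp flip: tensor_class_add tensor_class_zero)
qed

definition slot :: "'n \<Rightarrow> 'a \<Rightarrow> ('n, 'a::comm_monoid_mult, 'k::field) prod_algebra" where
  "slot p a = monomial ((\<lambda>_. 1)(p := a))"

abbreviation bracket_rep :: "'a \<Rightarrow> ('n::finite, 'a::comm_monoid_mult, 'k::field) prod_algebra" where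
  "bracket_rep a \<equiv> (\<Sum>p\<in>UNIV. slot p a)"

lemma monomial_mult: "monomial f * monomial g = monomial (\<lambda>i. f i * g i)"
  by (simp add: monomial_def mult_single plus_factors_def)

lemma slot_mult: "slot p (x * y) = slot p x * slot p y"
  by (auto simp: slot_def monomial_mult intro!: arg_cong[of _ _ monomial])

lemma monomial_one: "monomial (\<lambda>_. 1) = 1"
  by (simp add: monomial_def flip: zero_factors_def)

lemma slot_one: "slot p 1 = 1"
  by (simp add: slot_def monomial_one fun_upd_idem)

lemma prod_slot:
  fixes f :: "'n::finite \<Rightarrow> 'a::comm_monoid_mult"
  shows "(\<Prod>p\<in>UNIV. slot p (f p)) = (monomial f :: ('n, 'a, 'k::field) prod_algebra)"
proof -
  have "(\<Prod>p\<in>A. slot p (f p)) =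
      (monomial (\<lambda>p. if p \<in> A then f p else 1) :: ('n, 'a, 'k) prod_algebra)" for A :: "'n set"
    by (induction A rule: infinite_finite_induct)
      (auto simp: monomial_one slot_def monomial_mult intro!: arg_cong[of _ _ monomial])
  then show ?thesis by simp
qed

lemma tensor_class_bracket_rep:
  fixes scale :: "'k::field \<Rightarrow> 'a::comm_ring_1 \<Rightarrow> 'a"
  shows "tensor_class scale (bracket_rep a) = (bracket scale a :: ('n::finite, 'a, 'k) tensor)"
proof -
  interpret T: cring "tensor_power scale" by (rule cring_tensor_power)
  have slot: "tensor_class scale (slot p a) = pure_tensor scale ((\<lambda>_. 1)(p := a))" for p :: 'n
    by (simp add: pure_tensor_def slot_def)
  have "pure_tensor scale f \<in> carrier (tensor_power scale)" for f :: "'n \<Rightarrow> 'a"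
    by (simp add: pure_tensor_def carrier_tensor_power)
  then have "tensor_class scale (\<Sum>p\<in>A. slot p a) =
      (\<Oplus>\<^bsub>tensor_power scale\<^esub>p\<in>A. pure_tensor scale ((\<lambda>_. 1)(p := a)))" for A :: "'n set"
    by (induction A rule: infinite_finite_induct)
      (simp_all add: tensor_class_zero tensor_class_add slot)
  then show ?thesis by (simp add: bracket_def)
qed

lemma scalar_add: "scalar (c + d) = scalar c + scalar d"
  by (simp add: scalar_def single_add)

lemma scalar_mult: "scalar (c * d) = scalar c * scalar d"
  by (simp add: scalar_def mult_single)

lemma scalar_one: "scalar 1 = 1"
  by (simp add: scalar_def)

lemma scalar_of_nat: "scalar (of_nat m) = of_nat m"
  by (simp add: scalar_def)

lemma scalar_times_monomial: "scalar c * monomial f = Poly_Mapping.single (Factors f) c"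
  by (simp add: scalar_def monomial_def mult_single)

lemma prod_algebra_induct [case_names add single]:
  fixes p :: "('n, 'a::comm_monoid_mult, 'k::field) prod_algebra"
  assumes add: "\<And>p q. Q p \<Longrightarrow> Q q \<Longrightarrow> Q (p + q)"
    and single: "\<And>c f. Q (scalar c * monomial f)"
  shows "Q p"
proof (induction p rule: update_induct)
  case const
  show ?case using single[of 0] by (simp add: scalar_def)
next
  case (update p t c)
  have "Poly_Mapping.update t c p = p + scalar c * monomial (factor t)"
    using update.hyps
    by (intro poly_mapping_eqI)
      (auto simp: lookup_update lookup_add lookup_single when_def in_keys_iff scalar_times_monomial)
  then show ?case using update.IH single add by simp
qed

section \<open>Permuting tensor factors\<close>

context
  fixes \<sigma> :: "'n \<Rightarrow> 'n"
  assumes \<sigma>: "bij \<sigma>"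
begin

lemma inj_permute: "inj (\<lambda>t :: ('n, 'a) factors. Factors (factor t \<circ> \<sigma>))"
proof (rule injI)
  fix s t :: "('n, 'a) factors"
  assume eq: "Factors (factor s \<circ> \<sigma>) = Factors (factor t \<circ> \<sigma>)"
  have "factor s i = factor t i" for i
    using eq bij_is_surj[OF \<sigma>] by (metis comp_apply factors.inject surjD)
  then show "s = t" by (intro factors.expand ext)
qed

lemma permute_factors_add:
  "permute_factors \<sigma> (p + p') = permute_factors \<sigma> p + permute_factors \<sigma> (p' :: ('n, 'a, 'k::monoid_add) prod_algebra)"
  unfolding permute_factors_def by (rule map_key_plus[OF inj_permute])

lemma permute_factors_term:
  "permute_factors \<sigma> (scalar c * monomial f) = scalar c * monomial (f \<circ> inv_into UNIV \<sigma>)"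
proof -
  have "factor (Factors (f \<circ> inv_into UNIV \<sigma>)) \<circ> \<sigma> = f"
    using \<sigma> by (simp add: comp_assoc bij_is_inj)
  then show ?thesis
    using map_key_single[OF inj_permute, of "Factors (f \<circ> inv_into UNIV \<sigma>)" c]
    by (simp add: permute_factors_def scalar_times_monomial)
qed

lemma permute_factors_mult:
  fixes p p' :: "('n, 'a::comm_monoid_mult, 'k::field) prod_algebra"
  shows "permute_factors \<sigma> (p * p') = permute_factors \<sigma> p * permute_factors \<sigma> p'"
proof (induction p rule: prod_algebra_induct)
  case (single c f)
  show ?case
  proof (induction p' rule: prod_algebra_induct)
    case (single d g)
    have mult: "scalar c * monomial f' * (scalar d * monomial g') =
        (scalar (c * d) * monomial (\<lambda>i. f' i * g' i) :: ('n, 'a, 'k) prod_algebra)" for f' g'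
      by (simp add: scalar_mult mult_ac flip: monomial_mult)
    show ?case by (simp add: mult permute_factors_term comp_def)
  qed (simp add: permute_factors_add distrib_left)
qed (simp add: permute_factors_add distrib_right)

lemma permute_factors_scalar: "permute_factors \<sigma> (scalar c) = scalar c"
  using permute_factors_term[of c "\<lambda>_. 1"] by (simp add: monomial_one comp_def)

text \<open>
  A permutation maps the multilinearity relations in slot \<open>i\<close> to those in slot \<open>\<sigma> i\<close>, and it acts
  by ring homomorphisms.
\<close>
lemma permute_factors_tensor_ideal:
  fixes scale :: "'k::field \<Rightarrow> 'a::comm_ring_1 \<Rightarrow> 'a"
  assumes "p \<in> tensor_ideal scale"
  shows "permute_factors \<sigma> p \<in> tensor_ideal scale"
proof -
  let ?J = "{p. permute_factors \<sigma> p \<in> tensor_ideal scale}"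
  have inv_eq: "inv_into UNIV \<sigma> j = i \<longleftrightarrow> j = \<sigma> i" for i j
    using bij_inv_eq_iff[OF \<sigma>, of i j] by auto
  have upd: "(f(i := x)) \<circ> inv_into UNIV \<sigma> = (f \<circ> inv_into UNIV \<sigma>)(\<sigma> i := x)" for f :: "'n \<Rightarrow> 'a" and i x
    using inv_eq[of _ i] by (auto simp: fun_eq_iff)
  have diff: "permute_factors \<sigma> (p - p') = permute_factors \<sigma> p - permute_factors \<sigma> p'"
    for p p' :: "('n, 'a, 'k) prod_algebra"
    using permute_factors_add[of "p - p'" p'] by (simp add: algebra_simps)
  have mono: "permute_factors \<sigma> (monomial f) = monomial (f \<circ> inv_into UNIV \<sigma>)" for f :: "'n \<Rightarrow> 'a"
    using permute_factors_term[of 1 f] by (simp add: scalar_one)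
  have "tensor_ideal scale \<subseteq> ?J"
  proof (rule tensor_ideal_minimal)
    have "permute_factors \<sigma> r \<in> multilinear_relations scale" if r: "r \<in> multilinear_relations scale" for r
    proof -
      consider (add) f i x y where "r = monomial (f(i := x + y)) - monomial (f(i := x)) - monomial (f(i := y))"
        | (scale) f i c x where "r = monomial (f(i := scale c x)) - scalar c * monomial (f(i := x))"
        using r unfolding multilinear_relations_def by blast
      then show ?thesis
      proof cases
        case add
        then show ?thesis
          unfolding multilinear_relations_def add diff mono upd by blast
      next
        case scale
        then show ?thesis
          unfolding multilinear_relations_def scale diff mono permute_factors_term upd by blast
      qed
    qed
    then show "multilinear_relations scale \<subseteq> ?J"
      using multilinear_relations_subset by blast
    show "0 \<in> ?J" using diff[of 0 0] by (simp add: tensor_ideal_zero)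
  qed (auto simp: permute_factors_add permute_factors_mult tensor_ideal_add tensor_ideal_mult)
  then show ?thesis using assms by auto
qed

end

lemma permute_tensor_class:
  assumes \<sigma>: "bij \<sigma>"
  shows "permute_tensor \<sigma> (tensor_class scale p) = tensor_class scale (permute_factors \<sigma> p)"
proof -
  have "h \<in> permute_factors \<sigma> ` tensor_ideal scale" if h: "h \<in> tensor_ideal scale" for h
  proof (rule image_eqI)
    have "permute_factors \<sigma> (permute_factors (inv_into UNIV \<sigma>) h) = h"
      by (induction h rule: prod_algebra_induct)
        (simp_all add: permute_factors_add permute_factors_term \<sigma> bij_imp_bij_inv
          inv_inv_eq comp_assoc bij_is_surj surj_iff[THEN iffD1])
    then show "h = permute_factors \<sigma> (permute_factors (inv_into UNIV \<sigma>) h)" by simp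
    show "permute_factors (inv_into UNIV \<sigma>) h \<in> tensor_ideal scale"
      by (rule permute_factors_tensor_ideal[OF bij_imp_bij_inv[OF \<sigma>] h])
  qed
  then have stable: "permute_factors \<sigma> ` tensor_ideal scale = tensor_ideal scale"
    using permute_factors_tensor_ideal[OF \<sigma>] by blast
  have "permute_factors \<sigma> ` (\<lambda>h. h + p) ` tensor_ideal scale =
      (\<lambda>h. h + permute_factors \<sigma> p) ` permute_factors \<sigma> ` tensor_ideal scale"
    unfolding image_image permute_factors_add[OF \<sigma>] ..
  then show ?thesis
    unfolding permute_tensor_def tensor_class_eq stable .
qed

lemma class_in_symmetric_iff:
  "tensor_class scale p \<in> carrier (symmetric_tensors scale) \<longleftrightarrow>
    (\<forall>\<sigma>. bij \<sigma> \<longrightarrow> tensor_class scale (permute_factors \<sigma> p) = tensor_class scale p)"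
  by (simp add: symmetric_tensors_def carrier_tensor_power permute_tensor_class)

lemma scalar_class_symmetric: "tensor_class scale (scalar c) \<in> carrier (symmetric_tensors scale)"
  by (simp add: class_in_symmetric_iff permute_factors_scalar)

lemma ring_symmetric_tensors:
  fixes scale :: "'k::field \<Rightarrow> 'a::comm_ring_1 \<Rightarrow> 'a"
  shows "ring (symmetric_tensors scale :: ('n, 'a, 'k) tensor ring)"
proof -
  interpret T: cring "tensor_power scale :: ('n, 'a, 'k) tensor ring" by (rule cring_tensor_power)
  have sub: "carrier (symmetric_tensors scale :: ('n, 'a, 'k) tensor ring) \<subseteq> range (tensor_class scale)"
    by (auto simp: symmetric_tensors_def carrier_tensor_power)
  have mult: "h1 \<otimes>\<^bsub>tensor_power scale\<^esub> h2 \<in> carrier (symmetric_tensors scale)"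
    and add: "h1 \<oplus>\<^bsub>tensor_power scale\<^esub> h2 \<in> carrier (symmetric_tensors scale)"
    if h: "h1 \<in> carrier (symmetric_tensors scale)" "h2 \<in> carrier (symmetric_tensors scale)"
    for h1 h2 :: "('n, 'a, 'k) tensor"
  proof -
    from h obtain p q where pq: "h1 = tensor_class scale p" "h2 = tensor_class scale q"
      using sub by blast
    show "h1 \<otimes>\<^bsub>tensor_power scale\<^esub> h2 \<in> carrier (symmetric_tensors scale)"
      using h unfolding pq tensor_class_mult[symmetric] class_in_symmetric_iff
      by (simp add: permute_factors_mult tensor_class_mult)
    show "h1 \<oplus>\<^bsub>tensor_power scale\<^esub> h2 \<in> carrier (symmetric_tensors scale)"
      using h unfolding pq tensor_class_add[symmetric] class_in_symmetric_iff
      by (simp add: permute_factors_add tensor_class_add)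
  qed
  have "subring (carrier (symmetric_tensors scale :: ('n, 'a, 'k) tensor ring)) (tensor_power scale)"
  proof (rule T.subringI)
    show "carrier (symmetric_tensors scale) \<subseteq> carrier (tensor_power scale)"
      by (auto simp: symmetric_tensors_def)
    show "\<one>\<^bsub>tensor_power scale\<^esub> \<in> carrier (symmetric_tensors scale)"
      using scalar_class_symmetric[of scale 1] by (simp add: scalar_one tensor_class_one)
  next
    fix h :: "('n, 'a, 'k) tensor" assume h: "h \<in> carrier (symmetric_tensors scale)"
    then obtain p where p: "h = tensor_class scale p" using sub by blast
    have "- p = scalar (- 1) * p"
      by (simp add: scalar_def single_uminus)
    then show "\<ominus>\<^bsub>tensor_power scale\<^esub> h \<in> carrier (symmetric_tensors scale)"
      using mult[OF scalar_class_symmetric[of scale "- 1"] h]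
      unfolding p tensor_class_mult[symmetric] tensor_class_uminus[symmetric] by simp
  qed (use mult add in auto)
  then show ?thesis
    using T.subring_is_ring by (simp add: symmetric_tensors_def)
qed

lemma bracket_symmetric:
  fixes scale :: "'k::field \<Rightarrow> 'a::comm_ring_1 \<Rightarrow> 'a"
  shows "bracket scale a \<in> carrier (symmetric_tensors scale :: ('n::finite, 'a, 'k) tensor ring)"
proof -
  have "permute_factors \<sigma> (bracket_rep a) = (bracket_rep a :: ('n, 'a, 'k) prod_algebra)" if \<sigma>: "bij \<sigma>"
    for \<sigma> :: "'n \<Rightarrow> 'n"
  proof -
    have zero: "permute_factors \<sigma> (0 :: ('n, 'a, 'k) prod_algebra) = 0"
      using permute_factors_scalar[OF \<sigma>, of 0] by (simp add: scalar_def)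
    have slot: "permute_factors \<sigma> (slot p a) = (slot (\<sigma> p) a :: ('n, 'a, 'k) prod_algebra)" for p :: 'n
    proof -
      have "(\<lambda>_. 1)(p := a) \<circ> inv_into UNIV \<sigma> = (\<lambda>_. 1)(\<sigma> p := a)"
      proof
        fix j
        have "inv_into UNIV \<sigma> j = p \<longleftrightarrow> j = \<sigma> p"
          using bij_inv_eq_iff[OF \<sigma>, of p j] by auto
        then show "((\<lambda>_. 1)(p := a) \<circ> inv_into UNIV \<sigma>) j = ((\<lambda>_. 1)(\<sigma> p := a)) j" by simp
      qed
      then show ?thesis
        using permute_factors_term[OF \<sigma>, of 1 "(\<lambda>_. 1)(p := a)"]
        by (simp add: slot_def scalar_one)
    qed
    have "permute_factors \<sigma> (\<Sum>p\<in>A. slot p a) = (\<Sum>p\<in>A. slot (\<sigma> p) a :: ('n, 'a, 'k) prod_algebra)" for A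
      by (induction A rule: infinite_finite_induct) (simp_all add: zero permute_factors_add \<sigma> slot)
    also have "(\<Sum>p\<in>UNIV. slot (\<sigma> p) a) = (bracket_rep a :: ('n, 'a, 'k) prod_algebra)"
      by (rule sum.reindex_bij_betw[OF \<sigma>])
    finally show ?thesis .
  qed
  then show ?thesis
    by (simp add: class_in_symmetric_iff flip: tensor_class_bracket_rep)
qed

section \<open>Invariants as averages of orbit sums\<close>

lemma scalar_multiple_mem:
  assumes "subring_of_type C" "range scalar \<subseteq> C" "c \<noteq> 0" "scalar c * p \<in> C"
  shows "p \<in> C"
proof -
  have "scalar (inverse c) * (scalar c * p) \<in> C"
    by (rule subring_of_type.mult_closed[OF assms(1) subsetD[OF assms(2) rangeI] assms(4)])
  moreover have "scalar (inverse c) * (scalar c * p) = scalar (inverse c * c) * p"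
    by (simp only: scalar_mult mult.assoc)
  ultimately show ?thesis using assms(3) by (simp add: scalar_one)
qed

text \<open>
  Averaging: modulo the tensor ideal, the sum of all permutations of an invariant \<open>p\<close> is
  \<open>fact CARD('n)\<close> times \<open>p\<close>. Term by term this sum consists of scalar multiples of orbit sums, and
  these lie in \<open>C\<close> by the congruence for placement sums, applied to words with a single letter and
  with every element of \<open>A\<close> allowed as a letter.
\<close>
lemma symmetric_tensor_mem:
  fixes C :: "('n::finite, 'a::comm_ring_1, 'k::field) prod_algebra set"
  assumes "subring_of_type C" and scal: "range scalar \<subseteq> C" and ideal: "tensor_ideal scale \<subseteq> C"
    and br: "\<And>a. bracket_rep a \<in> C" and fact: "of_nat (fact CARD('n)) \<noteq> (0 :: 'k)"
    and sym: "tensor_class scale p \<in> carrier (symmetric_tensors scale)"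
  shows "p \<in> C"
proof -
  interpret subring_of_type C by fact
  have M: "placement_sum slot {} xs \<in> C" for xs :: "'a list"
  proof (cases "xs = []")
    case False
    have [simp]: "concat (map (\<lambda>x. [x]) xs) = xs" by (induction xs) auto
    have "placement_sum slot {} (map prod_list (map (\<lambda>x. [x]) xs)) -
        (- 1) ^ (length (map (\<lambda>x. [x]) xs) - 1) * of_nat (fact (length (map (\<lambda>x. [x]) xs) - 1)) *
          bracket_rep (prod_list (concat (map (\<lambda>x. [x]) xs))) \<in> C"
      by (rule placement_sum_mod_subring[of slot UNIV "Suc (length xs)"])
        (use False in \<open>auto simp: slot_mult br\<close>)
    then have "placement_sum slot {} xs -
        (- 1) ^ (length xs - 1) * of_nat (fact (length xs - 1)) * bracket_rep (prod_list xs) \<in> C"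
      by (simp add: comp_def)
    moreover have "(- 1) ^ (length xs - 1) * of_nat (fact (length xs - 1)) *
        bracket_rep (prod_list xs) \<in> C"
      by (intro mult_closed power_closed uminus_closed one_closed of_nat_closed br)
    ultimately show ?thesis using add_closed by fastforce
  qed (simp add: one_closed)
  obtain ps where ps: "set ps = (UNIV :: 'n set)" "distinct ps"
    using finite_distinct_list[of "UNIV :: 'n set"] by auto
  have orbit: "(\<Sum>\<sigma> | bij \<sigma>. permute_factors \<sigma> r) \<in> C" for r
  proof (induction r rule: prod_algebra_induct)
    case (single c f)
    have "permute_factors \<sigma> (scalar c * monomial f) = scalar c * (\<Prod>i\<in>UNIV. slot (\<sigma> i) (f i))"
      if "bij \<sigma>" for \<sigma>
    proof -
      have "(\<Prod>i\<in>UNIV. slot (\<sigma> i) (f i) :: ('n, 'a, 'k) prod_algebra) =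
          (\<Prod>i\<in>UNIV. slot (\<sigma> i) ((f \<circ> inv_into UNIV \<sigma>) (\<sigma> i)))"
        using that by (simp add: bij_is_inj)
      also have "\<dots> = monomial (f \<circ> inv_into UNIV \<sigma>)"
        by (rule trans[OF prod.reindex_bij_betw[OF that, of "\<lambda>i. slot i ((f \<circ> inv_into UNIV \<sigma>) i)"]
            prod_slot])
      finally show ?thesis by (simp add: permute_factors_term[OF that])
    qed
    then have "(\<Sum>\<sigma> | bij \<sigma>. permute_factors \<sigma> (scalar c * monomial f)) =
        scalar c * placement_sum slot {} (map f ps)"
      by (simp add: sum_distrib_left flip: sum_bij_eq_placement_sum[OF ps(2,1)])
    then show ?case using scal M by (auto intro: mult_closed)
  next
    case (add r r')
    then show ?case
      by (simp add: permute_factors_add sum.distrib add_closed)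
  qed
  have "(\<Sum>\<sigma> | bij \<sigma>. permute_factors \<sigma> p - p) \<in> C"
    using sym ideal by (intro sum_closed) (auto simp: class_in_symmetric_iff tensor_class_eq_iff)
  moreover have "card {\<sigma> :: 'n \<Rightarrow> 'n. bij \<sigma>} = fact CARD('n)"
    using card_permutations[OF refl, of "UNIV :: 'n set"]
    by (simp only: permutes_univ bij_iff[symmetric] finite)
  ultimately have "(\<Sum>\<sigma> | bij \<sigma>. permute_factors \<sigma> p) - scalar (of_nat (fact CARD('n))) * p \<in> C"
    by (simp add: sum_subtractf scalar_of_nat)
  from diff_closed[OF orbit[of p] this] have "scalar (of_nat (fact CARD('n))) * p \<in> C"
    by simp
  then show ?thesis using scalar_multiple_mem[OF assms(1,2) fact] by blast
qed

section \<open>Graded algebras generated in a single degree\<close>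

context graded_algebra
begin

lemma mult_scale: "x * scale c y = scale c (x * y)"
  using scale_mult[of c y x] by (simp add: mult.commute)

lemma span_mult:
  assumes AB: "\<And>x y. x \<in> A \<Longrightarrow> y \<in> B \<Longrightarrow> x * y \<in> span C"
    and "x \<in> span A" "y \<in> span B"
  shows "x * y \<in> span C"
proof -
  have sub: "subspace {y. x * y \<in> span C}" for x
    by (intro subspaceI) (auto simp: distrib_left mult_scale span_zero span_add span_scale)
  have "A \<subseteq> {x. y * x \<in> span C}"
  proof
    fix x assume "x \<in> A"
    then have "span B \<subseteq> {y. x * y \<in> span C}"
      using AB by (intro span_minimal sub) auto
    then show "x \<in> {x. y * x \<in> span C}" using assms(3) by (auto simp: mult.commute)
  qed
  then have "span A \<subseteq> {x. y * x \<in> span C}" by (intro span_minimal sub)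
  then show ?thesis using assms(2) by (auto simp: mult.commute)
qed

definition component :: "nat \<Rightarrow> 'a \<Rightarrow> 'a" where
  "component d x =
     (THE f. finite {d. f d \<noteq> 0} \<and> (\<forall>d. f d \<in> gr d) \<and> x = (\<Sum>d | f d \<noteq> 0. f d)) d"

lemma component_decomposition:
  shows finite_component: "finite {d. component d x \<noteq> 0}"
    and component_gr: "component d x \<in> gr d"
    and component_sum: "x = (\<Sum>d | component d x \<noteq> 0. component d x)"
  using theI'[OF gr_direct_sum[of x]] unfolding component_def by auto

lemma component_eqI:
  assumes D: "finite D" "\<And>d. f d \<in> gr d" "\<And>d. d \<notin> D \<Longrightarrow> f d = 0" "x = (\<Sum>d\<in>D. f d)"
  shows "component d x = f d"
proof -
  have sub: "{d. f d \<noteq> 0} \<subseteq> D" using D(3) by auto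
  have "finite {d. f d \<noteq> 0} \<and> (\<forall>d. f d \<in> gr d) \<and> x = (\<Sum>d | f d \<noteq> 0. f d)"
    using D sub by (auto intro: finite_subset sum.mono_neutral_right)
  then have "(THE f. finite {d. f d \<noteq> 0} \<and> (\<forall>d. f d \<in> gr d) \<and> x = (\<Sum>d | f d \<noteq> 0. f d)) = f"
    by (rule the1_equality[OF gr_direct_sum])
  then show ?thesis by (simp add: component_def)
qed

lemma component_sum_superset:
  "finite D \<Longrightarrow> {d. component d x \<noteq> 0} \<subseteq> D \<Longrightarrow> x = (\<Sum>d\<in>D. component d x)"
  by (subst component_sum) (rule sum.mono_neutral_left, auto)

lemma component_add: "component d (x + y) = component d x + component d y"
proof (rule component_eqI)
  let ?D = "{d. component d x \<noteq> 0} \<union> {d. component d y \<noteq> 0}"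
  show "finite ?D" by (simp add: finite_component)
  show "x + y = (\<Sum>d\<in>?D. component d x + component d y)"
    using component_sum_superset[of ?D x] component_sum_superset[of ?D y]
    by (simp add: sum.distrib finite_component)
qed (auto intro: subspace_add gr_subspace component_gr)

lemma component_scale: "component d (scale c x) = scale c (component d x)"
proof (rule component_eqI)
  let ?D = "{d. component d x \<noteq> 0}"
  show "finite ?D" by (simp add: finite_component)
  show "scale c x = (\<Sum>d\<in>?D. scale c (component d x))"
    by (subst component_sum[of x]) (rule scale_sum_right)
qed (auto intro: subspace_scale gr_subspace component_gr)

lemma component_homogeneous: "x \<in> gr d \<Longrightarrow> component e x = (if e = d then x else 0)"
  by (rule component_eqI[where D = "{d}"]) (auto intro: subspace_0 gr_subspace)

lemma homogeneous_induct:
  assumes "subspace V" "\<And>d. gr d \<subseteq> V"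
  shows "x \<in> V"
  using subspace_sum[OF assms(1), of "{d. component d x \<noteq> 0}" "\<lambda>d. component d x"]
    assms(2) component_gr component_sum[of x] by auto

lemma component_0_mult: "b \<in> gr d \<Longrightarrow> 0 < d \<Longrightarrow> component 0 (b * x) = 0"
proof -
  assume b: "b \<in> gr d" "0 < d"
  have "x \<in> {x. component 0 (b * x) = 0}"
  proof (rule homogeneous_induct)
    show "subspace {x. component 0 (b * x) = 0}"
      using component_scale[of 0 0 0]
      by (intro subspaceI) (auto simp: component_add component_scale distrib_left mult_scale)
    show "gr e \<subseteq> {x. component 0 (b * x) = 0}" for e
      using component_homogeneous[OF gr_mult[OF b(1)], of _ e 0] b(2) by auto
  qed
  then show ?thesis by simp
qed

definition filtration :: "nat \<Rightarrow> 'a set" where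
  "filtration m = span (\<Union>d\<in>{m..}. gr d)"

lemma filtration_mult:
  assumes "x \<in> filtration m" "y \<in> filtration l"
  shows "x * y \<in> filtration (m + l)"
proof -
  show ?thesis
    using _ assms unfolding filtration_def
  proof (rule span_mult)
    fix x y assume "x \<in> (\<Union>d\<in>{m..}. gr d)" "y \<in> (\<Union>d\<in>{l..}. gr d)"
    then obtain d e where "x * y \<in> gr (d + e)" "m + l \<le> d + e"
      using gr_mult add_mono by fastforce
    then show "x * y \<in> span (\<Union>d\<in>{m + l..}. gr d)" by (intro span_base) auto
  qed
qed

lemma filtration_prod:
  assumes "finite A" "\<And>i. i \<in> A \<Longrightarrow> f i \<in> filtration m"
  shows "prod f A \<in> filtration (card A * m)"
  using assms
proof (induction rule: finite_induct)
  case empty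
  show ?case unfolding filtration_def using gr_one by (auto intro: span_base)
next
  case (insert i A)
  then show ?case using filtration_mult[of "f i" m "prod f A"] by simp
qed

lemma component_filtration:
  assumes "x \<in> filtration m" "d < m"
  shows "component d x = 0"
proof -
  have "subspace {x. component d x = 0}"
    using component_scale[of d 0 0]
    by (intro subspaceI) (auto simp: component_add component_scale)
  moreover have "(\<Union>d\<in>{m..}. gr d) \<subseteq> {x. component d x = 0}"
    using assms(2) component_homogeneous by auto
  ultimately show ?thesis
    using assms(1) span_minimal unfolding filtration_def by blast
qed

definition positive_part :: "'a \<Rightarrow> 'a" where
  "positive_part x = x - component 0 x"

lemma prod_list_gr: "set gs \<subseteq> gr q \<Longrightarrow> prod_list gs \<in> gr (length gs * q)"
  by (induction gs) (auto simp: gr_one gr_mult)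

text \<open>
  The span of all words in the generators is closed under multiplication.
\<close>
lemma generated_subalgebra_subset_span:
  "generated_subalgebra ring_of_type_algebra (\<lambda>c. scale c 1) G \<subseteq> span (prod_list ` {gs. set gs \<subseteq> G})"
proof
  fix x assume "x \<in> generated_subalgebra ring_of_type_algebra (\<lambda>c. scale c 1) G"
  then show "x \<in> span (prod_list ` {gs. set gs \<subseteq> G})"
    unfolding generated_subalgebra_def
  proof (induction rule: generate_ring.induct)
    case one
    have "prod_list [] \<in> prod_list ` {gs. set gs \<subseteq> G}" by (rule imageI) simp
    then show ?case by (auto simp: ring_of_type_algebra_def intro: span_base)
  next
    case (incl x)
    have "prod_list [] \<in> prod_list ` {gs. set gs \<subseteq> G}" by (rule imageI) simp
    moreover have "prod_list [x] \<in> prod_list ` {gs. set gs \<subseteq> G}" if "x \<in> G"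
      by (rule imageI) (simp add: that)
    ultimately show ?case using incl by (auto intro: span_base span_scale)
  next
    case (a_inv x)
    then show ?case by (simp add: a_inv_of_type span_neg)
  next
    case (eng_add x y)
    then show ?case by (simp add: ring_of_type_algebra_def span_add)
  next
    case (eng_mult x y)
    have "x * y \<in> span (prod_list ` {gs. set gs \<subseteq> G})"
      using _ eng_mult.IH
    proof (rule span_mult)
      fix x y assume "x \<in> prod_list ` {gs. set gs \<subseteq> G}" "y \<in> prod_list ` {gs. set gs \<subseteq> G}"
      then obtain gs hs where gs: "set gs \<subseteq> G" "set hs \<subseteq> G" "x * y = prod_list (gs @ hs)"
        by auto
      show "x * y \<in> span (prod_list ` {gs. set gs \<subseteq> G})"
        unfolding gs(3) by (intro span_base imageI) (use gs in simp)
    qed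
    then show ?case by (simp add: ring_of_type_algebra_def)
  qed
qed

text \<open>
  A word in generators of degree \<open>q\<close> has degree a multiple of \<open>q\<close>.
\<close>
lemma component_eq_0_below:
  assumes G: "G \<subseteq> gr q" "generated_subalgebra ring_of_type_algebra (\<lambda>c. scale c 1) G = UNIV"
    and "0 < d" "d < q"
  shows "component d x = 0"
proof -
  have "subspace {x. component d x = 0}"
    using component_scale[of d 0 0]
    by (intro subspaceI) (auto simp: component_add component_scale)
  moreover have "prod_list ` {gs. set gs \<subseteq> G} \<subseteq> {x. component d x = 0}"
  proof clarify
    fix gs assume "set gs \<subseteq> G"
    then have "prod_list gs \<in> gr (length gs * q)" using G by (intro prod_list_gr) auto
    moreover have "d \<noteq> length gs * q" using assms(3,4) by (cases "length gs") auto
    ultimately show "component d (prod_list gs) = 0" by (simp add: component_homogeneous)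
  qed
  ultimately show ?thesis
    using G(2) span_minimal generated_subalgebra_subset_span by blast
qed

lemma positive_part_filtration:
  assumes G: "G \<subseteq> gr q" "generated_subalgebra ring_of_type_algebra (\<lambda>c. scale c 1) G = UNIV"
  shows "positive_part x \<in> filtration q"
proof -
  let ?D = "insert 0 {d. component d x \<noteq> 0}"
  have "x = (\<Sum>d\<in>?D. component d x)"
    by (rule component_sum_superset) (auto simp: finite_component)
  also have "\<dots> = component 0 x + (\<Sum>d\<in>?D - {0}. component d x)"
    by (rule sum.remove) (auto simp: finite_component)
  finally have "positive_part x = (\<Sum>d\<in>?D - {0}. component d x)"
    by (simp add: positive_part_def algebra_simps)
  moreover have "component d x \<in> filtration q" if "d \<in> ?D - {0}" for d
  proof -
    have "q \<le> d" using that component_eq_0_below[OF G, of d x] by force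
    then show ?thesis unfolding filtration_def using component_gr by (intro span_base) auto
  qed
  ultimately show ?thesis
    unfolding filtration_def by (simp only: span_sum)
qed

end

section \<open>Linear functionals on the tensor power\<close>

definition linear_extension ::
    "(('n \<Rightarrow> 'a::comm_monoid_mult) \<Rightarrow> 'k::field) \<Rightarrow> ('n, 'a, 'k) prod_algebra \<Rightarrow> 'k" where
  "linear_extension F p = (\<Sum>t\<in>Poly_Mapping.keys p. Poly_Mapping.lookup p t * F (factor t))"

lemma linear_extension_add:
  "linear_extension F (p + p') = linear_extension F p + linear_extension F p'"
  unfolding linear_extension_def
  by (rule setsum_keys_plus_distrib) (simp_all add: distrib_right)

lemma linear_extension_term: "linear_extension F (scalar c * monomial f) = c * F f"
  by (simp add: linear_extension_def scalar_times_monomial)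

lemma linear_extension_monomial: "linear_extension F (monomial f) = F f"
  using linear_extension_term[of F 1 f] by (simp add: scalar_one)

lemma linear_extension_scalar:
  "linear_extension F (scalar c * p) = c * linear_extension F p"
proof (induction p rule: prod_algebra_induct)
  case (single d f)
  have "scalar c * (scalar d * monomial f) = scalar (c * d) * monomial f"
    by (simp only: scalar_mult mult.assoc)
  then show ?case by (simp add: linear_extension_term)
qed (simp add: linear_extension_add distrib_left)

lemma linear_extension_zero: "linear_extension F 0 = 0"
  by (simp add: linear_extension_def)

lemma linear_extension_diff:
  "linear_extension F (p - p') = linear_extension F p - linear_extension F p'"
  using linear_extension_add[of F "p - p'" p'] by (simp add: algebra_simps)

lemma linear_extension_sum: "linear_extension F (sum g A) = (\<Sum>i\<in>A. linear_extension F (g i))"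
  by (induction A rule: infinite_finite_induct)
    (simp_all add: linear_extension_zero linear_extension_add)

text \<open>
  Multilinear functions induce functionals on the tensor power. The tensor ideal is the smallest
  ideal that contains the relations, and the largest ideal inside the kernel of the functional
  contains them: a monomial times a relation in slot \<open>i\<close> is again a relation in slot \<open>i\<close>.
\<close>
lemma linear_extension_tensor_ideal:
  fixes scale :: "'k::field \<Rightarrow> 'a::comm_ring_1 \<Rightarrow> 'a" and F :: "('n \<Rightarrow> 'a) \<Rightarrow> 'k"
  assumes scale: "\<And>c x y. x * scale c y = scale c (x * y)"
    and F_add: "\<And>f i x y. F (f(i := x + y)) = F (f(i := x)) + F (f(i := y))"
    and F_scale: "\<And>f i c x. F (f(i := scale c x)) = c * F (f(i := x))"
    and p: "p \<in> tensor_ideal scale"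
  shows "linear_extension F p = 0"
proof -
  have "tensor_ideal scale \<subseteq> {p. \<forall>r. linear_extension F (r * p) = 0}"
  proof (rule tensor_ideal_minimal)
    show "multilinear_relations scale \<subseteq> {p. \<forall>r. linear_extension F (r * p) = 0}"
    proof (intro subsetI CollectI allI)
      fix p r :: "('n, 'a, 'k) prod_algebra" assume p: "p \<in> multilinear_relations scale"
      show "linear_extension F (r * p) = 0"
      proof (induction r rule: prod_algebra_induct)
        case (single c g)
        have upd: "monomial g * monomial (f(i := x)) = monomial ((\<lambda>j. g j * f j)(i := g i * x))"
          for f :: "'n \<Rightarrow> 'a" and i x
          by (auto simp: monomial_mult intro!: arg_cong[of _ _ monomial])
        consider (add) f i x y where
            "p = monomial (f(i := x + y)) - monomial (f(i := x)) - monomial (f(i := y))"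
          | (scale) f i d x where
            "p = monomial (f(i := scale d x)) - scalar d * monomial (f(i := x))"
          using p unfolding multilinear_relations_def by blast
        then have "linear_extension F (monomial g * p) = 0"
        proof cases
          case add
          show ?thesis
            unfolding add right_diff_distrib upd
            by (simp add: linear_extension_diff linear_extension_monomial F_add distrib_left)
        next
          case scale
          have "monomial g * (scalar d * monomial (f(i := x))) =
              scalar d * (monomial g * monomial (f(i := x)))"
            by (simp only: mult.left_commute)
          then show ?thesis
            unfolding scale right_diff_distrib
            by (simp add: upd linear_extension_diff linear_extension_monomial
                linear_extension_scalar F_scale assms(1))
        qed
        then show ?case by (simp add: mult.assoc linear_extension_scalar)
      qed (simp add: distrib_right linear_extension_add)
    qed
  qed (auto simp: linear_extension_zero linear_extension_add distrib_left simp flip: mult.assoc)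
  then have "linear_extension F (1 * p) = 0" using p by blast
  then show ?thesis by simp
qed

section \<open>A functional vanishing on decomposable elements\<close>

text \<open>
  The solution of $k c_k + (n-k) c_{k+1} = 0$ for $0 < k < n$ with $c_0 = 0$ and $n c_1 = 1$; for
  invertible $n!$ it is $c_k = (-1)^{k-1} (k-1)!\,(n-k)!/n!$ for $1 \le k \le n$, the reciprocal of the number of injective
  placements of $k$ elements times the coefficient $(-1)^{k-1} (k-1)!$ of their bracket.
\<close>
primrec subset_coeff :: "nat \<Rightarrow> nat \<Rightarrow> 'k::field" where
  "subset_coeff n 0 = 0"
| "subset_coeff n (Suc k) =
     (if k = 0 then 1 else - (of_nat k * subset_coeff n k)) / of_nat (n - k)"

lemma subset_coeff_rec:
  assumes "of_nat (n - k) \<noteq> (0 :: 'k::field)"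
  shows "of_nat k * subset_coeff n k + of_nat (n - k) * subset_coeff n (Suc k) =
    (if k = 0 then 1 else 0 :: 'k)"
  using assms by simp

text \<open>
  Each \<open>S\<close> occurs once for each of its elements \<open>j\<close>, and once for each \<open>j\<close> outside it as
  \<open>insert j S - {j}\<close>.
\<close>
lemma sum_subsets_with_marked_element:
  fixes c :: "nat \<Rightarrow> 'k::comm_ring_1" and g :: "'n::finite set \<Rightarrow> 'k"
  shows "(\<Sum>j\<in>UNIV. \<Sum>S | j \<in> S. c (card S) * (g S + g (S - {j}))) =
    (\<Sum>S\<in>UNIV. (of_nat (card S) * c (card S) + of_nat (CARD('n) - card S) * c (Suc (card S))) * g S)"
proof -
  have "(\<Sum>j\<in>UNIV. \<Sum>S | j \<in> S. c (card S) * g S) = (\<Sum>S\<in>UNIV. of_nat (card S) * (c (card S) * g S))"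
    using sum.swap_restrict[of UNIV UNIV "\<lambda>j S. c (card S) * g S" "\<lambda>j S. j \<in> S"] by simp
  moreover have "(\<Sum>j\<in>UNIV. \<Sum>S | j \<in> S. c (card S) * g (S - {j})) =
      (\<Sum>S\<in>UNIV. of_nat (CARD('n) - card S) * (c (Suc (card S)) * g S))"
  proof -
    have card: "Suc (card S - Suc 0) = card S" if "j \<in> S" for j and S :: "'n set"
      using that by (intro Suc_pred) (auto simp: card_gt_0_iff)
    have "(\<Sum>S | j \<in> S. c (card S) * g (S - {j})) = (\<Sum>S | j \<notin> S. c (Suc (card S)) * g S)" for j
      by (rule sum.reindex_bij_witness[of _ "insert j" "\<lambda>S. S - {j}"])
        (auto simp: insert_absorb card)
    then have "(\<Sum>j\<in>UNIV. \<Sum>S | j \<in> S. c (card S) * g (S - {j})) =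
        (\<Sum>S\<in>UNIV. \<Sum>j | j \<notin> S. c (Suc (card S)) * g S)"
      using sum.swap_restrict[of UNIV UNIV "\<lambda>j S. c (Suc (card S)) * g S" "\<lambda>j S. j \<notin> S"] by simp
    moreover have "card {j. j \<notin> S} = CARD('n) - card S" for S :: "'n set"
      by (simp add: Collect_neg_eq Compl_eq_Diff_UNIV card_Diff_subset)
    ultimately show ?thesis by simp
  qed
  ultimately show ?thesis
    by (simp add: distrib_left distrib_right sum.distrib mult.assoc)
qed

text \<open>
  The parameter \<open>index\<close> only fixes the type that indexes the tensor factors.
\<close>
locale graded_functional = graded_algebra scale gr
  for scale :: "'k::field \<Rightarrow> 'a::comm_ring_1 \<Rightarrow> 'a" and gr +
  fixes l :: "'a \<Rightarrow> 'k" and index :: "'n::finite itself"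
  assumes l_add: "l (x + y) = l x + l y"
    and l_scale: "l (scale c x) = c * l x"
begin

definition split_product :: "('n \<Rightarrow> 'a) \<Rightarrow> 'n set \<Rightarrow> 'a" where
  "split_product f S = (\<Prod>i\<in>UNIV. if i \<in> S then positive_part (f i) else component 0 (f i))"

text \<open>
  The functional $\Phi$ of the introduction, as a function of the factors of a pure tensor.
\<close>
definition indecomposable_functional :: "('n \<Rightarrow> 'a) \<Rightarrow> 'k" where
  "indecomposable_functional f =
     (\<Sum>S\<in>UNIV. subset_coeff CARD('n) (card S) * l (split_product f S))"

lemma positive_part_add: "positive_part (x + y) = positive_part x + positive_part y"
  by (simp add: positive_part_def component_add)

lemma positive_part_scale: "positive_part (scale c x) = scale c (positive_part x)"
  by (simp add: positive_part_def component_scale scale_right_diff_distrib)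

lemma split_product_upd:
  "split_product (f(i := x)) S = (if i \<in> S then positive_part x else component 0 x) *
    (\<Prod>j\<in>UNIV - {i}. if j \<in> S then positive_part (f j) else component 0 (f j))"
proof -
  have "(\<Prod>j\<in>UNIV - {i}. if j \<in> S then positive_part ((f(i := x)) j) else component 0 ((f(i := x)) j)) =
      (\<Prod>j\<in>UNIV - {i}. if j \<in> S then positive_part (f j) else component 0 (f j))"
    by (rule prod.cong) auto
  then show ?thesis
    unfolding split_product_def by (subst prod.remove[of _ i]) simp_all
qed

lemma indecomposable_functional_add:
  "indecomposable_functional (f(i := x + y)) =
    indecomposable_functional (f(i := x)) + indecomposable_functional (f(i := y))"
  unfolding indecomposable_functional_def split_product_upd sum.distrib[symmetric]
  by (intro sum.cong refl)
    (simp add: positive_part_add component_add distrib_left distrib_right l_add)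

lemma indecomposable_functional_scale:
  "indecomposable_functional (f(i := scale c x)) = c * indecomposable_functional (f(i := x))"
  unfolding indecomposable_functional_def split_product_upd sum_distrib_left
  by (intro sum.cong refl)
    (simp add: positive_part_scale component_scale l_scale mult.left_commute flip: scale_mult)

lemma l_0: "l 0 = 0"
  using l_scale[of 0 0] by simp

text \<open>
  Multiplying the factor \<open>j\<close> by \<open>b\<close> makes it purely of positive degree, so only the subsets \<open>S\<close> that
  contain \<open>j\<close> contribute; splitting the old factor \<open>f j\<close> again, such an \<open>S\<close> contributes the
  terms of \<open>S\<close> and of \<open>S - {j}\<close>. In the sum over \<open>j\<close> the term of a subset of size $k$ acquires the
  coefficient $k c_k + (n-k) c_{k+1}$, which is $0$ unless $k = 0$ or $k = n$; the term for $k = n$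
  is excluded by hypothesis \<open>top\<close>.
\<close>
lemma indecomposable_functional_bracket_mult:
  assumes b: "b \<in> gr d" "0 < d"
    and char: "\<And>k. 0 < k \<Longrightarrow> k \<le> CARD('n) \<Longrightarrow> of_nat k \<noteq> (0 :: 'k)"
    and top: "l (b * split_product f UNIV) = 0"
  shows "linear_extension indecomposable_functional (bracket_rep b * monomial f) =
    l (b * split_product f {})"
proof -
  let ?c = "subset_coeff CARD('n) :: nat \<Rightarrow> 'k"
  let ?g = "\<lambda>S. l (b * split_product f S)"
  have upd: "indecomposable_functional (f(j := b * f j)) =
      (\<Sum>S | j \<in> S. ?c (card S) * (?g S + ?g (S - {j})))" for j
  proof -
    have pos: "positive_part (b * f j) = b * f j"
      by (simp add: positive_part_def component_0_mult[OF b])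
    have eq: "split_product (f(j := b * f j)) S =
        b * split_product f S + b * split_product f (S - {j})" if "j \<in> S" for S
    proof -
      let ?P = "\<Prod>i\<in>UNIV - {j}. if i \<in> S then positive_part (f i) else component 0 (f i)"
      have "split_product f (S - {j}) = component 0 (f j) * ?P"
      proof -
        have "(\<Prod>i\<in>UNIV - {j}. if i \<in> S - {j} then positive_part (f i) else component 0 (f i)) = ?P"
          by (rule prod.cong) auto
        then show ?thesis using split_product_upd[of f j "f j" "S - {j}"] by simp
      qed
      moreover have "split_product f S = positive_part (f j) * ?P"
        using split_product_upd[of f j "f j" S] that by auto
      moreover have "split_product (f(j := b * f j)) S = b * (f j * ?P)"
        using that by (simp add: split_product_upd pos mult.assoc)
      moreover have "f j * ?P = positive_part (f j) * ?P + component 0 (f j) * ?P"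
        by (simp only: positive_part_def distrib_right[symmetric] diff_add_cancel)
      ultimately show ?thesis by (simp only: distrib_left)
    qed
    have "indecomposable_functional (f(j := b * f j)) =
        (\<Sum>S | j \<in> S. ?c (card S) * l (split_product (f(j := b * f j)) S))"
      unfolding indecomposable_functional_def
      by (rule sum.mono_neutral_right)
        (auto simp: split_product_upd component_0_mult[OF b] l_0)
    then show ?thesis by (simp add: eq l_add)
  qed
  have "bracket_rep b * monomial f = (\<Sum>j\<in>UNIV. monomial (f(j := b * f j)) :: ('n, 'a, 'k) prod_algebra)"
    unfolding sum_distrib_right slot_def monomial_mult
    by (intro sum.cong refl arg_cong[of _ _ monomial]) auto
  then have "linear_extension indecomposable_functional (bracket_rep b * monomial f) =
      (\<Sum>j\<in>UNIV. indecomposable_functional (f(j := b * f j)))"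
    by (simp add: linear_extension_sum linear_extension_monomial)
  also have "\<dots> = (\<Sum>S\<in>UNIV. (of_nat (card S) * ?c (card S) +
      of_nat (CARD('n) - card S) * ?c (Suc (card S))) * ?g S)"
    unfolding upd by (rule sum_subsets_with_marked_element)
  also have "\<dots> = (\<Sum>S\<in>UNIV. if S = ({} :: 'n set) then ?g {} else 0)"
  proof (rule sum.cong[OF refl])
    fix S :: "'n set"
    show "(of_nat (card S) * ?c (card S) + of_nat (CARD('n) - card S) * ?c (Suc (card S))) * ?g S =
        (if S = {} then ?g {} else 0)"
    proof (cases "S = UNIV")
      case False
      then have "card S < CARD('n)" by (simp add: psubset_card_mono psubsetI)
      then have "of_nat (CARD('n) - card S) \<noteq> (0 :: 'k)" by (intro char) auto
      from subset_coeff_rec[OF this] show ?thesis by simp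
    qed (use top in simp)
  qed
  finally show ?thesis by simp
qed

end

section \<open>Brackets of low degree generate\<close>

context graded_algebra
begin

text \<open>
  Linearity of the bracket holds modulo the multilinearity relations only.
\<close>
lemma subspace_bracket_rep:
  fixes C :: "('n::finite, 'a, 'k) prod_algebra set"
  assumes "subring_of_type C" and scal: "range scalar \<subseteq> C" and ideal: "tensor_ideal scale \<subseteq> C"
  shows "subspace {a. bracket_rep a \<in> C}"
proof -
  interpret C: subring_of_type C by fact
  have slot_add: "slot p (x + y) - slot p x - slot p y \<in> C" for p x y
  proof -
    have "slot p (x + y) - slot p x - slot p y \<in> multilinear_relations scale"
      unfolding slot_def multilinear_relations_def by blast
    then show ?thesis using ideal multilinear_relations_subset by blast
  qed
  have slot_scale: "slot p (scale c x) - scalar c * slot p x \<in> C" for p c x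
  proof -
    have "slot p (scale c x) - scalar c * slot p x \<in> multilinear_relations scale"
      unfolding slot_def multilinear_relations_def by blast
    then show ?thesis using ideal multilinear_relations_subset by blast
  qed
  have bracket_scale: "bracket_rep (scale c x) \<in> C" if "bracket_rep x \<in> C" for c x
  proof -
    have "(\<Sum>p\<in>UNIV. slot p (scale c x) - scalar c * slot p x) \<in> C"
      by (rule C.sum_closed) (rule slot_scale)
    moreover have "scalar c * bracket_rep x \<in> C"
      using scal that by (intro C.mult_closed) auto
    ultimately have "(\<Sum>p\<in>UNIV. slot p (scale c x) - scalar c * slot p x) + scalar c * bracket_rep x \<in> C"
      by (rule C.add_closed)
    then show ?thesis by (simp add: sum_subtractf sum_distrib_left)
  qed
  have bracket_add: "bracket_rep (x + y) \<in> C" if "bracket_rep x \<in> C" "bracket_rep y \<in> C" for x y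
  proof -
    have "(\<Sum>p\<in>UNIV. slot p (x + y) - slot p x - slot p y) \<in> C"
      by (rule C.sum_closed) (rule slot_add)
    then have "(\<Sum>p\<in>UNIV. slot p (x + y) - slot p x - slot p y) + (bracket_rep x + bracket_rep y) \<in> C"
      using that by (intro C.add_closed)
    then show ?thesis by (simp add: sum_subtractf)
  qed
  have "bracket_rep 0 \<in> C"
  proof -
    have "bracket_rep (scale 0 1) \<in> C"
      by (rule bracket_scale) (simp add: slot_one C.of_nat_closed)
    then show ?thesis by simp
  qed
  then show ?thesis using bracket_add bracket_scale by (intro subspaceI) auto
qed

text \<open>
  By induction on the length, the bracket of every word in the generators lies in \<open>C\<close>. Words of
  length at most \<open>CARD('n)\<close> have low degree. A longer word is cut into \<open>CARD('n)\<close> letters and one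
  remaining word; the placement sum of these \<open>CARD('n) + 1\<close> entries is $0$, and modulo \<open>C\<close> it is
  an invertible multiple of the bracket of the whole word.
\<close>
lemma bracket_rep_mem:
  fixes C :: "('n::finite, 'a, 'k) prod_algebra set"
  assumes "subring_of_type C" and scal: "range scalar \<subseteq> C" and ideal: "tensor_ideal scale \<subseteq> C"
    and fact: "of_nat (fact CARD('n)) \<noteq> (0 :: 'k)"
    and G: "G \<subseteq> gr q" "generated_subalgebra ring_of_type_algebra (\<lambda>c. scale c 1) G = UNIV"
    and q: "0 < q"
    and low: "\<And>d x. 0 < d \<Longrightarrow> d < (CARD('n) + 1) * q \<Longrightarrow> x \<in> gr d \<Longrightarrow> bracket_rep x \<in> C"
  shows "bracket_rep a \<in> C"
proof -
  interpret C: subring_of_type C by fact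
  let ?n = "CARD('n)"
  have prod: "bracket_rep (prod_list gs) \<in> C" if "set gs \<subseteq> G" for gs
    using that
  proof (induction "length gs" arbitrary: gs rule: less_induct)
    case less
    consider "gs = []" | "0 < length gs" "length gs \<le> ?n" | "?n < length gs"
      by (metis length_greater_0_conv not_less)
    then show ?case
    proof cases
      case 1
      then show ?thesis by (simp add: slot_one C.of_nat_closed)
    next
      case 2
      then have "0 < length gs * q" using q by simp
      moreover have "length gs * q < (?n + 1) * q"
        using 2 q by (intro mult_less_mono1) auto
      moreover have "prod_list gs \<in> gr (length gs * q)"
        using less.prems G(1) by (intro prod_list_gr) auto
      ultimately show ?thesis by (rule low)
    next
      case 3
      let ?gss = "map (\<lambda>g. [g]) (take ?n gs) @ [drop ?n gs]"
      have "concat (map (\<lambda>g. [g]) hs) = hs" for hs :: "'a list" by (induction hs) auto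
      then have concat: "concat ?gss = gs" by simp
      have len: "length ?gss = Suc ?n" using 3 by simp
      have "placement_sum slot {} (map prod_list ?gss) -
          (- 1) ^ (length ?gss - 1) * of_nat (fact (length ?gss - 1)) *
            bracket_rep (prod_list (concat ?gss)) \<in> C"
      proof (rule C.placement_sum_mod_subring[of slot G "length gs"])
        show "bracket_rep (prod_list hs) \<in> C" if "set hs \<subseteq> G" "length hs < length gs" for hs
          using less.hyps that by blast
        show "g \<noteq> [] \<and> set g \<subseteq> G" if "g \<in> set ?gss" for g
          using that less.prems 3 set_take_subset[of ?n gs] set_drop_subset[of ?n gs] by auto
        show "length (concat ?gss) \<le> length gs" by (simp only: concat)
      qed (auto simp: slot_mult)
      then have "(- 1) ^ ?n * of_nat (fact ?n) * bracket_rep (prod_list gs) \<in> C"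
        using C.uminus_closed
        unfolding concat len by (subst (asm) placement_sum_eq_0) (use 3 in fastforce)+
      then have "(- 1) ^ ?n * ((- 1) ^ ?n * of_nat (fact ?n) * bracket_rep (prod_list gs)) \<in> C"
        by (rule C.mult_closed[OF C.power_closed[OF C.uminus_closed[OF C.one_closed]]])
      moreover have "(- 1) ^ ?n * ((- 1) ^ ?n * of_nat (fact ?n) * bracket_rep (prod_list gs)) =
          scalar (of_nat (fact ?n)) * (bracket_rep (prod_list gs) :: ('n, 'a, 'k) prod_algebra)"
        by (simp add: scalar_of_nat mult.assoc[symmetric] power_mult_distrib[symmetric])
      ultimately show ?thesis
        using scalar_multiple_mem[OF assms(1) scal fact] by simp
    qed
  qed
  have "span (prod_list ` {gs. set gs \<subseteq> G}) \<subseteq> {a. bracket_rep a \<in> C}"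
    by (rule span_minimal[OF _ subspace_bracket_rep[OF assms(1) scal ideal]]) (auto intro: prod)
  then show ?thesis
    using generated_subalgebra_subset_span[of G] G(2) by blast
qed

end

section \<open>No bracket is redundant\<close>

context graded_functional
begin

text \<open>
  The elements \<open>p\<close> for which multiplication by \<open>p\<close> acts on the functional $\Phi$ as a scalar, that
  is $\Phi(p\,y) = e\,\Phi(y)$ for all \<open>y\<close>, form a subalgebra. It contains \<open>[b]\<close> for \<open>b\<close> in \<open>B\<close>, with $e = 0$.
  Since $\Phi(1) = 0$, the functional vanishes on this subalgebra, whereas $\Phi([b_0]) = l(b_0) = 1$.
\<close>
lemma bracket_not_generated:
  fixes B :: "'a set"
  assumes connected: "gr 0 = range (\<lambda>c. scale c 1)"
    and char: "\<And>k. 0 < k \<Longrightarrow> k \<le> CARD('n) \<Longrightarrow> of_nat k \<noteq> (0 :: 'k)"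
    and pos: "\<And>b. b \<in> insert b0 B \<Longrightarrow> \<exists>d>0. b \<in> gr d"
    and top: "\<And>b f. b \<in> insert b0 B \<Longrightarrow> l (b * split_product f UNIV) = 0"
    and l_B: "\<And>b. b \<in> B \<Longrightarrow> l b = 0" and l_b0: "l b0 = 1"
  shows "(bracket scale b0 :: ('n, 'a, 'k) tensor) \<notin>
    generated_subalgebra (symmetric_tensors scale) (tensor_scalar scale) (bracket scale ` B)"
proof
  let ?R = "symmetric_tensors scale :: ('n, 'a, 'k) tensor ring"
  let ?L = "linear_extension indecomposable_functional"
  define Q where "Q p \<longleftrightarrow> (\<exists>e. \<forall>r. ?L (p * r) = e * ?L r)" for p
  interpret R: ring ?R by (rule ring_symmetric_tensors)
  have R_simps: "x \<oplus>\<^bsub>?R\<^esub> y = x \<oplus>\<^bsub>tensor_power scale\<^esub> y" "x \<otimes>\<^bsub>?R\<^esub> y = x \<otimes>\<^bsub>tensor_power scale\<^esub> y"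
    "\<one>\<^bsub>?R\<^esub> = \<one>\<^bsub>tensor_power scale\<^esub>" "\<zero>\<^bsub>?R\<^esub> = \<zero>\<^bsub>tensor_power scale\<^esub>" for x y
    by (simp_all add: symmetric_tensors_def)
  have L_ideal: "?L p = 0" if "p \<in> tensor_ideal scale" for p
    by (rule linear_extension_tensor_ideal[of scale, OF mult_scale indecomposable_functional_add
          indecomposable_functional_scale that])
  have L_bracket: "?L (bracket_rep b * monomial f) = l (b * split_product f {})"
    if "b \<in> insert b0 B" for b f
    using pos[OF that] indecomposable_functional_bracket_mult[OF _ _ char top[OF that]] by blast
  have Q_bracket: "Q (bracket_rep b)" if b: "b \<in> B" for b
  proof -
    \<comment> \<open>The degree 0 parts multiply to a scalar because \<open>A\<close> is connected.\<close>
    have zero: "l (b * split_product f {}) = 0" for f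
    proof -
      have "(\<Prod>i\<in>A. component 0 (f i)) \<in> gr 0" for A :: "'n set"
        using gr_mult[of _ 0 _ 0] component_gr
        by (induction A rule: infinite_finite_induct) (auto simp: gr_one)
      then obtain c where "split_product f {} = scale c 1"
        using connected by (auto simp: split_product_def)
      then show ?thesis by (simp add: mult_scale l_scale l_B[OF b])
    qed
    have "?L (bracket_rep b * r) = 0" for r
    proof (induction r rule: prod_algebra_induct)
      case (single c f)
      have "bracket_rep b * (scalar c * monomial f) = scalar c * (bracket_rep b * monomial f)"
        by (simp only: mult.left_commute)
      then have "?L (bracket_rep b * (scalar c * monomial f)) = c * ?L (bracket_rep b * monomial f)"
        by (simp only: linear_extension_scalar)
      then show ?case using b by (simp only: L_bracket insertI2 zero mult_zero_right)
    qed (simp add: distrib_left linear_extension_add)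
    then show ?thesis unfolding Q_def by (intro exI[of _ 0]) simp
  qed
  let ?H = "range (tensor_scalar scale) \<union> bracket scale ` B"
  have H: "?H \<subseteq> carrier ?R"
    using scalar_class_symmetric bracket_symmetric by (auto simp: tensor_scalar_def)
  have Q_rep: "\<exists>p. t = tensor_class scale p \<and> Q p" if "t \<in> generate_ring ?R ?H" for t
    using that
  proof (induction rule: generate_ring.induct)
    case one
    have "Q 1" unfolding Q_def by (intro exI[of _ 1]) simp
    then show ?case using tensor_class_one[of scale] R_simps(3) by metis
  next
    case (incl t)
    have "Q (scalar c)" for c
      unfolding Q_def by (intro exI[of _ c]) (simp add: linear_extension_scalar)
    then show ?case
      using incl Q_bracket by (auto simp: tensor_scalar_def simp flip: tensor_class_bracket_rep)
  next
    case (a_inv t)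
    then obtain p e where p: "t = tensor_class scale p" "\<And>r. ?L (p * r) = e * ?L r"
      by (auto simp: Q_def)
    \<comment> \<open>The negative in the ring of invariants is relative to its carrier; a representative \<open>p'\<close> of it
      satisfies \<open>p' + p = 0\<close> modulo the tensor ideal only.\<close>
    have t: "t \<in> carrier ?R" using R.generate_ring_in_carrier[OF H a_inv.hyps] .
    then have "\<ominus>\<^bsub>?R\<^esub> t \<in> carrier (tensor_power scale)"
      using R.a_inv_closed by (auto simp: symmetric_tensors_def)
    then obtain p' where p': "\<ominus>\<^bsub>?R\<^esub> t = tensor_class scale p'"
      by (auto simp: carrier_tensor_power)
    have "tensor_class scale (p' + p) = tensor_class scale 0"
      using R.l_neg[OF t] unfolding p' by (simp add: p(1) R_simps tensor_class_add tensor_class_zero)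
    then have "p' + p \<in> tensor_ideal scale" by (simp add: tensor_class_eq_iff)
    then have "?L (r * (p' + p)) = 0" for r by (intro L_ideal tensor_ideal_mult)
    then have sum: "?L (p' * r + p * r) = 0" for r by (metis distrib_right mult.commute)
    have "?L (p' * r) = - e * ?L r" for r
      using sum[of r] p(2)[of r] by (simp add: linear_extension_add eq_neg_iff_add_eq_0)
    then show ?case using p' unfolding Q_def by blast
  next
    case (eng_add t u)
    then obtain p p' e e' where p: "t = tensor_class scale p" "\<And>r. ?L (p * r) = e * ?L r"
      "u = tensor_class scale p'" "\<And>r. ?L (p' * r) = e' * ?L r"
      by (auto simp: Q_def)
    have "Q (p + p')"
      unfolding Q_def by (intro exI[of _ "e + e'"]) (simp add: distrib_right linear_extension_add p)
    then show ?case using p(1,3) by (auto simp: R_simps simp flip: tensor_class_add)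
  next
    case (eng_mult t u)
    then obtain p p' e e' where p: "t = tensor_class scale p" "\<And>r. ?L (p * r) = e * ?L r"
      "u = tensor_class scale p'" "\<And>r. ?L (p' * r) = e' * ?L r"
      by (auto simp: Q_def)
    have "Q (p * p')"
      unfolding Q_def by (intro exI[of _ "e * e'"]) (simp add: mult.assoc p)
    then show ?case using p(1,3) by (auto simp: R_simps simp flip: tensor_class_mult)
  qed
  have comp_1: "component 0 1 = 1" "positive_part 1 = 0"
    using component_homogeneous[OF gr_one, of 0] by (auto simp: positive_part_def)
  have "split_product (\<lambda>_. 1) S = 0" if "S \<noteq> {}" for S
    unfolding split_product_def by (rule prod_zero) (use that comp_1 in auto)
  then have "indecomposable_functional (\<lambda>_. 1) = 0"
    unfolding indecomposable_functional_def
    by (intro sum.neutral ballI) (metis card.empty l_0 mult_eq_0_iff subset_coeff.simps(1))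
  then have L_1: "?L 1 = 0"
    using linear_extension_monomial[of indecomposable_functional "\<lambda>_. 1"] by (simp add: monomial_one)
  assume "(bracket scale b0 :: ('n, 'a, 'k) tensor) \<in> generated_subalgebra ?R (tensor_scalar scale) (bracket scale ` B)"
  then obtain p where p: "bracket scale b0 = tensor_class scale p" "Q p"
    unfolding generated_subalgebra_def using Q_rep by blast
  then have "p - bracket_rep b0 \<in> tensor_ideal scale"
    by (metis tensor_class_bracket_rep tensor_class_eq_iff)
  then have "?L p = ?L (bracket_rep b0 * monomial (\<lambda>_. 1))"
    using L_ideal by (fastforce simp: linear_extension_diff monomial_one)
  also have "\<dots> = 1"
    by (simp add: L_bracket split_product_def comp_1 l_b0)
  finally have "?L (p * 1) = 1" by simp
  moreover obtain e where "?L (p * 1) = e * ?L 1" using p(2) unfolding Q_def by blast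
  ultimately show False using L_1 by simp
qed

end

lemma bracket_homogeneous:
  assumes "graded_algebra scale gr" "b \<in> gr d"
  shows "bracket scale b \<in> symmetric_tensor_gr scale gr d"
proof -
  interpret graded_algebra scale gr by fact
  interpret P: Modules.module "\<lambda>c p. scalar c * p :: ('c::finite, 'b, 'a) prod_algebra"
    by unfold_locales (simp_all add: scalar_add scalar_mult scalar_one algebra_simps)
  have "bracket_rep b \<in> P.span {monomial f | f. \<exists>deg. (\<forall>i. f i \<in> gr (deg i)) \<and> (\<Sum>i\<in>UNIV. deg i) = d}"
  proof (intro P.span_sum P.span_base)
    fix p :: 'c
    have "\<forall>i. ((\<lambda>_. 1)(p := b)) i \<in> gr (((\<lambda>_. 0)(p := d)) i)"
      using assms(2) gr_one by simp
    moreover have "(\<Sum>i\<in>UNIV. ((\<lambda>_. 0)(p := d)) i) = d"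
      by (simp add: fun_upd_def)
    ultimately show "slot p b \<in> {monomial f | f. \<exists>deg. (\<forall>i. f i \<in> gr (deg i)) \<and> (\<Sum>i\<in>UNIV. deg i) = d}"
      unfolding slot_def by blast
  qed
  then show ?thesis
    using bracket_symmetric[of scale b]
    by (auto simp: symmetric_tensor_gr_def tensor_gr_def simp flip: tensor_class_bracket_rep)
qed

lemma of_nat_neq_0:
  assumes "CHAR('k::field) = 0 \<or> CHAR('k) > n" "0 < k" "k \<le> n"
  shows "of_nat k \<noteq> (0 :: 'k)"
  using assms by (auto simp: of_nat_eq_0_iff_char_dvd dest: dvd_imp_le)

section \<open>Minimal generating systems of brackets\<close>

theorem corollary2:
  fixes scale :: "'k::field \<Rightarrow> 'a::comm_ring_1 \<Rightarrow> 'a"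
    and gr basis :: "nat \<Rightarrow> 'a set"
    and G :: "'a set"
    and q :: nat
  assumes char_K: "CHAR('k) = 0 \<or> CHAR('k) > CARD('n)"
    and graded: "graded_algebra scale gr"
    and connected: "gr 0 = range (\<lambda>c. scale c 1)"
    and q_pos: "q > 0"
    and G_homogeneous: "G \<subseteq> gr q"
    and G_generates:
      "generated_subalgebra ring_of_type_algebra (\<lambda>c. scale c 1) G = UNIV"
    and basis: "\<And>d. 0 < d \<Longrightarrow> d < (CARD('n) + 1) * q \<Longrightarrow>
      basis d \<subseteq> gr d \<and> module.independent scale (basis d) \<and> module.span scale (basis d) = gr d"
  shows "minimal_homogeneous_generating_system
    (symmetric_tensors scale :: ('n::finite, 'a, 'k) tensor ring)
    (tensor_scalar scale) (symmetric_tensor_gr scale gr)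
    (bracket scale ` (\<Union>d\<in>{0<..<(CARD('n) + 1) * q}. basis d))"
proof -
  interpret graded_algebra scale gr by (rule graded)
  let ?R = "symmetric_tensors scale :: ('n, 'a, 'k) tensor ring"
  define B where "B = (\<Union>d\<in>{0<..<(CARD('n) + 1) * q}. basis d)"
  have char: "of_nat k \<noteq> (0 :: 'k)" if "0 < k" "k \<le> CARD('n)" for k
    using of_nat_neq_0[OF char_K] that .
  have "of_nat (fact k) \<noteq> (0 :: 'k)" if "k \<le> CARD('n)" for k
    using that
  proof (induction k)
    case (Suc k)
    have "of_nat (fact (Suc k)) = (of_nat (Suc k) * of_nat (fact k) :: 'k)"
      by (simp only: fact_Suc of_nat_mult of_nat_id)
    then show ?case using Suc char[of "Suc k"] by (simp del: of_nat_Suc)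
  qed simp
  then have fact: "of_nat (fact CARD('n)) \<noteq> (0 :: 'k)" by simp
  interpret R: ring ?R by (rule ring_symmetric_tensors)

  have B_pos: "\<exists>d>0. d < (CARD('n) + 1) * q \<and> b \<in> basis d \<and> b \<in> gr d" if b: "b \<in> B" for b
  proof -
    obtain d where d: "0 < d" "d < (CARD('n) + 1) * q" "b \<in> basis d"
      using b by (auto simp: B_def)
    then show ?thesis using basis[OF d(1,2)] by blast
  qed
  have homogeneous: "bracket scale ` B \<subseteq> (\<Union>d. symmetric_tensor_gr scale gr d :: ('n, 'a, 'k) tensor set)"
  proof
    fix t :: "('n, 'a, 'k) tensor" assume "t \<in> bracket scale ` B"
    then obtain b where b: "t = bracket scale b" "b \<in> B" by blast
    then obtain d where "b \<in> gr d" using B_pos by blast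
    then show "t \<in> (\<Union>d. symmetric_tensor_gr scale gr d)"
      unfolding b using bracket_homogeneous[OF graded] by blast
  qed

  have generates: "generated_subalgebra ?R (tensor_scalar scale) (bracket scale ` B) = carrier ?R"
  proof
    let ?S = "generated_subalgebra ?R (tensor_scalar scale) (bracket scale ` B)"
    have "range (tensor_scalar scale) \<union> bracket scale ` B \<subseteq> carrier ?R"
      using scalar_class_symmetric bracket_symmetric by (auto simp: tensor_scalar_def)
    then show "?S \<subseteq> carrier ?R"
      unfolding generated_subalgebra_def by (rule R.generate_ring_incl)
    \<comment> \<open>The preimage of the subalgebra, on which the lemmas about the monoid algebra apply.\<close>
    define C where "C = {p :: ('n, 'a, 'k) prod_algebra. tensor_class scale p \<in> ?S}"
    have scal: "scalar c \<in> C" for c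
      by (auto simp: C_def generated_subalgebra_def tensor_scalar_def intro: generate_ring.incl)
    have mult: "p * p' \<in> C" and add: "p + p' \<in> C" if "p \<in> C" "p' \<in> C" for p p'
      using that generate_ring.eng_mult[of _ ?R] generate_ring.eng_add[of _ ?R]
      by (simp_all add: C_def generated_subalgebra_def tensor_class_mult tensor_class_add symmetric_tensors_def)
    have C: "subring_of_type C"
    proof
      show "1 \<in> C" using scal[of 1] by (simp add: scalar_one)
      show "p - p' \<in> C" if "p \<in> C" "p' \<in> C" for p p'
        using add[OF that(1) mult[OF scal[of "- 1"] that(2)]] by (simp add: scalar_def single_uminus)
    qed (rule mult)
    have ideal: "tensor_ideal scale \<subseteq> C"
    proof
      fix p :: "('n, 'a, 'k) prod_algebra" assume "p \<in> tensor_ideal scale"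
      then have "tensor_class scale p = tensor_class scale (scalar 0)"
        by (simp add: tensor_class_eq_iff scalar_def)
      then show "p \<in> C" using scal[of 0] by (simp add: C_def)
    qed
    have bracket_B: "bracket_rep b \<in> C" if "b \<in> B" for b
      using that by (auto simp: C_def generated_subalgebra_def tensor_class_bracket_rep intro: generate_ring.incl)
    have low: "bracket_rep x \<in> C" if "0 < d" "d < (CARD('n) + 1) * q" "x \<in> gr d" for d x
    proof -
      have "basis d \<subseteq> B"
        unfolding B_def by (rule UN_upper) (use that in simp)
      then have "span (basis d) \<subseteq> {a. bracket_rep a \<in> C}"
        using bracket_B scal by (intro span_minimal subspace_bracket_rep C ideal) auto
      then show ?thesis using basis[OF that(1,2)] that(3) by auto
    qed
    have "bracket_rep a \<in> C" for a
      by (rule bracket_rep_mem[OF C _ ideal fact G_homogeneous G_generates q_pos low]) (auto simp: scal)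
    then have "p \<in> C" if "tensor_class scale p \<in> carrier ?R" for p
      using scal by (intro symmetric_tensor_mem[OF C _ ideal _ fact that]) auto
    then show "carrier ?R \<subseteq> ?S"
      by (auto simp: C_def symmetric_tensors_def carrier_tensor_power)
  qed

  have minimal: "generated_subalgebra ?R (tensor_scalar scale) S' \<noteq> carrier ?R"
    if S': "S' \<subset> bracket scale ` B" for S'
  proof
    assume gen: "generated_subalgebra ?R (tensor_scalar scale) S' = carrier ?R"
    obtain b0 where b0: "b0 \<in> B" "bracket scale b0 \<notin> S'" using S' by auto
    then obtain d0 where d0: "b0 \<in> basis d0" "0 < d0" "d0 < (CARD('n) + 1) * q"
      by (auto simp: B_def)
    note basis_d0 = basis[OF d0(2,3)]
    obtain B' where B': "B' \<subseteq> B" "S' = bracket scale ` B'"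
      using S' by (metis psubset_imp_subset subset_imageE)
    have b0_B': "b0 \<notin> B'" using b0 B' by auto
    \<comment> \<open>The functional dual to \<open>b0\<close> in its degree and zero in all other degrees.\<close>
    define l where "l x = representation (basis d0) (component d0 x) b0" for x
    have in_span: "component d0 x \<in> span (basis d0)" for x
      using basis_d0 component_gr by blast
    interpret graded_functional scale gr l "TYPE('n)"
      by unfold_locales
        (use basis_d0 in_span in \<open>simp_all add: l_def component_add component_scale
          representation_add representation_scale\<close>)
    have l_eq_0: "l x = 0" if "component d0 x = 0" for x
      using that by (simp add: l_def representation_zero)
    have top: "l (b * split_product f UNIV) = 0" if "b \<in> filtration q" for b f
    proof -
      have "(\<Prod>i\<in>UNIV. positive_part (f i)) \<in> filtration (CARD('n) * q)"
        by (intro filtration_prod positive_part_filtration[OF G_homogeneous G_generates]) auto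
      from filtration_mult[OF that this]
      show ?thesis
        by (intro l_eq_0 component_filtration[of _ "(CARD('n) + 1) * q"])
          (use d0 in \<open>simp_all add: split_product_def\<close>)
    qed
    have B_filtration: "b \<in> filtration q" if b: "b \<in> B" for b
    proof -
      obtain d where d: "0 < d" "b \<in> gr d" using B_pos[OF b] by auto
      then have "positive_part b = b"
        using component_homogeneous[of b d 0] by (simp add: positive_part_def)
      then show ?thesis
        using positive_part_filtration[OF G_homogeneous G_generates, of b] by simp
    qed
    have l_B': "l b = 0" if b: "b \<in> B'" for b
    proof -
      obtain d where d: "b \<in> basis d" "b \<in> gr d" using B_pos b B' by blast
      show ?thesis
      proof (cases "d = d0")
        case True
        then show ?thesis
          using d b b0_B' basis_d0 component_homogeneous[of b d d0]
          by (auto simp: l_def representation_basis)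
      qed (use component_homogeneous[OF d(2), of d0] l_eq_0 in simp)
    qed
    have l_b0: "l b0 = 1"
      using d0 basis_d0 component_homogeneous[of b0 d0 d0]
      by (auto simp: l_def representation_basis)
    have "bracket scale b0 \<notin> generated_subalgebra ?R (tensor_scalar scale) (bracket scale ` B')"
    proof (rule bracket_not_generated[OF connected char _ _ l_B' l_b0])
      fix b assume "b \<in> insert b0 B'"
      then have b: "b \<in> B" using b0 B' by auto
      show "\<exists>d>0. b \<in> gr d" using B_pos[OF b] by auto
      show "l (b * split_product f UNIV) = 0" for f by (rule top[OF B_filtration[OF b]])
    qed
    moreover have "bracket scale b0 \<in> carrier ?R" by (rule bracket_symmetric)
    ultimately show False using gen B'(2) by simp
  qed
  show ?thesis
    unfolding minimal_homogeneous_generating_system_def B_def[symmetric]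
    using homogeneous generates minimal by blast
qed

end
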